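(* Let $A$ be a hyper-Tauberian algebra, let $X$ be a Banach $A$-bimodule, and let $n\in\mathbb{N}$. Then every bounded local $n$-cocycle $T$ from $A^{(n)}$ into $X$ is an $n$-cocycle.
   Context: Hyper-Tauberian algebras. Let $A$ be a commutative regular semisimple Banach algebra with carrier space (character space) $\Phi_A$; elements of $A$ are regarded as functions on $\Phi_A$ via the Gelfand transform. The hull of a closed ideal $I$ of $A$ is $h(I)=\{t\in\Phi_A: a(t)=0 \text{ for all } a\in I\}$. For a Banach left (right) $A$-module $X$ and $x\in X$, let $\mathrm{Ann}_A(x)=\{a\in A: ax=0\ (xa=0)\}$, a closed ideal of $A$; the support of $x$ is $\mathrm{supp}\,x=h(\mathrm{Ann}_A(x))$. A linear operator $T\colon X\to Y$ between Banach left (right) $A$-modules is local if $\mathrm{supp}\,T(x)\subseteq\mathrm{supp}\,x$ for all $x\in X$. $A$ is hyper-Tauberian if every bounded local operator $T\colon A\to A^*$ is a multiplier, i.e. $T(ab)=aT(b)$ for all $a,b\in A$, where $A^*$ has its usual (symmetric) dual $A$-module structure. Cocycles. Let $A$ be a Banach algebra and $X$ a Banach $A$-bimodule. For $n\in\mathbb{N}=\{1,2,\dots\}$, $A^{(n)}$ is the Cartesian product of $n$ copies of $A$. For an $n$-linear map $T\colon A^{(n)}\to X$ define $$\delta^nT(a_1,\ldots,a_{n+1})=a_1T(a_2,\ldots,a_{n+1})+\sum_{j=1}^n(-1)^jT(a_1,\ldots,a_{j-1},a_ja_{j+1},\ldots,a_{n+1})+(-1)^{n+1}T(a_1,\ldots,a_n)a_{n+1}.$$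 $T$ is an $n$-cocycle if $\delta^nT=0$ (no boundedness is required). An $n$-linear map $T\colon A^{(n)}\to X$ is a local $n$-cocycle if for each $\tilde a=(a_1,\ldots,a_n)\in A^{(n)}$ there is an $n$-cocycle $T_{\tilde a}\colon A^{(n)}\to X$ (depending on $\tilde a$, not necessarily bounded) such that $T(\tilde a)=T_{\tilde a}(\tilde a)$. If in addition $T$ is bounded as an $n$-linear map, $T$ is a bounded local $n$-cocycle. *)

theory Defs
  imports "HOL-Analysis.Analysis"
begin

section \<open>Complex Banach spaces and Banach algebras\<close>

text \<open>
  The normed-space hierarchy of the library is real. The following classes add a complex scalar
  multiplication that extends the real one, so that norm, topology and completeness are those
  of the library.
\<close>

class complex_normed_vector = real_normed_vector +
  fixes scaleC :: "complex \<Rightarrow> 'a \<Rightarrow> 'a" (infixr "*\<^sub>C" 75)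
  assumes scaleC_add_right: "c *\<^sub>C (x + y) = c *\<^sub>C x + c *\<^sub>C y"
    and scaleC_add_left: "(c + d) *\<^sub>C x = c *\<^sub>C x + d *\<^sub>C x"
    and scaleC_scaleC: "c *\<^sub>C (d *\<^sub>C x) = (c * d) *\<^sub>C x"
    and scaleC_of_real: "complex_of_real r *\<^sub>C x = r *\<^sub>R x"
    and norm_scaleC: "norm (c *\<^sub>C x) = cmod c * norm x"

class complex_banach = complex_normed_vector + banach

text \<open>Neither a unit nor commutativity is assumed in the next class.\<close>

class complex_banach_algebra = complex_banach + real_normed_algebra +
  assumes mult_scaleC_left: "(c *\<^sub>C a) * b = c *\<^sub>C (a * b)"
    and mult_scaleC_right: "a * (c *\<^sub>C b) = c *\<^sub>C (a * b)"

class comm_complex_banach_algebra = complex_banach_algebra + comm_ring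

instantiation complex :: comm_complex_banach_algebra
begin

definition scaleC_complex :: "complex \<Rightarrow> complex \<Rightarrow> complex"
  where "scaleC_complex c x = c * x"

instance
  by standard (simp_all add: scaleC_complex_def algebra_simps norm_mult scaleR_conv_of_real)

end

definition clinear :: "('a::complex_normed_vector \<Rightarrow> 'b::complex_normed_vector) \<Rightarrow> bool"
  where "clinear f \<longleftrightarrow>
    (\<forall>x y. f (x + y) = f x + f y) \<and> (\<forall>c x. f (c *\<^sub>C x) = c *\<^sub>C f x)"

definition bounded_clinear :: "('a::complex_normed_vector \<Rightarrow> 'b::complex_normed_vector) \<Rightarrow> bool"
  where "bounded_clinear f \<longleftrightarrow> clinear f \<and> (\<exists>K. \<forall>x. norm (f x) \<le> K * norm x)"


section \<open>The dual space\<close>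

text \<open>The complex dual, as a subspace of the real bounded linear maps with the operator norm.\<close>

typedef (overloaded) 'a cdual =
  "{f :: 'a::complex_normed_vector \<Rightarrow>\<^sub>L complex. \<forall>c x. f (c *\<^sub>C x) = c * f x}"
  morphisms blinfun_of_cdual Abs_cdual
  by (rule exI[of _ 0]) simp

setup_lifting type_definition_cdual

lift_definition cdual_apply :: "'a::complex_normed_vector cdual \<Rightarrow> 'a \<Rightarrow> complex"
  is blinfun_apply .

instantiation cdual :: (complex_normed_vector) complex_normed_vector
begin

lift_definition zero_cdual :: "'a cdual" is 0
  by simp

lift_definition plus_cdual :: "'a cdual \<Rightarrow> 'a cdual \<Rightarrow> 'a cdual" is "(+)"
  by (simp add: blinfun.add_left algebra_simps)

lift_definition minus_cdual :: "'a cdual \<Rightarrow> 'a cdual \<Rightarrow> 'a cdual" is "(-)"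
  by (simp add: blinfun.diff_left algebra_simps)

lift_definition uminus_cdual :: "'a cdual \<Rightarrow> 'a cdual" is uminus
  by (simp add: blinfun.minus_left)

lift_definition scaleR_cdual :: "real \<Rightarrow> 'a cdual \<Rightarrow> 'a cdual" is scaleR
  by (simp add: blinfun.scaleR_left)

lift_definition scaleC_cdual :: "complex \<Rightarrow> 'a cdual \<Rightarrow> 'a cdual"
  is "\<lambda>c f. blinfun_compose (blinfun_mult_right c) f"
  by simp

lift_definition norm_cdual :: "'a cdual \<Rightarrow> real" is norm .

definition dist_cdual :: "'a cdual \<Rightarrow> 'a cdual \<Rightarrow> real"
  where "dist_cdual f g = norm (f - g)"

definition sgn_cdual :: "'a cdual \<Rightarrow> 'a cdual"
  where "sgn_cdual f = inverse (norm f) *\<^sub>R f"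

definition uniformity_cdual :: "('a cdual \<times> 'a cdual) filter"
  where "uniformity_cdual = (INF e\<in>{0 <..}. principal {(x, y). dist x y < e})"

definition open_cdual :: "'a cdual set \<Rightarrow> bool"
  where "open_cdual S \<longleftrightarrow> (\<forall>x\<in>S. \<forall>\<^sub>F (x', y) in uniformity. x' = x \<longrightarrow> y \<in> S)"

instance
proof
  fix c :: complex and f :: "'a cdual"
  have le: "norm (d *\<^sub>C g) \<le> cmod d * norm g" for d :: complex and g :: "'a cdual"
    by transfer
      (auto intro!: norm_blinfun_bound mult_left_mono norm_blinfun simp: norm_mult mult.assoc)
  show "norm (c *\<^sub>C f) = cmod c * norm f"
  proof (cases "c = 0")
    case True
    have "(0::complex) *\<^sub>C f = 0"
      by transfer (auto intro: blinfun_eqI)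
    moreover have "norm (0::'a cdual) = 0"
      by transfer simp
    ultimately show ?thesis
      using True by simp
  next
    case False
    have "inverse c *\<^sub>C c *\<^sub>C f = f"
      using False by transfer (auto intro!: blinfun_eqI simp: mult.assoc[symmetric])
    then have "norm f \<le> cmod (inverse c) * norm (c *\<^sub>C f)"
      using le[of "inverse c" "c *\<^sub>C f"] by simp
    then have "cmod c * norm f \<le> norm (c *\<^sub>C f)"
      using False by (simp add: norm_divide field_simps)
    then show ?thesis
      using le[of c f] by simp
  qed
qed (unfold dist_cdual_def sgn_cdual_def uniformity_cdual_def open_cdual_def,
    (rule refl | transfer,
      force intro: blinfun_eqI norm_triangle_ineq
        simp: blinfun.bilinear_simps algebra_simps scaleR_conv_of_real)+)

end

instance cdual :: (complex_normed_vector) complex_banach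
proof
  fix X :: "nat \<Rightarrow> 'a cdual"
  assume X: "Cauchy X"
  have dist_eq: "dist f g = dist (blinfun_of_cdual f) (blinfun_of_cdual g)" for f g :: "'a cdual"
    by (simp add: dist_cdual_def dist_norm norm_cdual.rep_eq minus_cdual.rep_eq)
  have "Cauchy (\<lambda>n. blinfun_of_cdual (X n))"
    using X by (simp add: Cauchy_def dist_eq)
  then obtain L where L: "(\<lambda>n. blinfun_of_cdual (X n)) \<longlonglongrightarrow> L"
    using Cauchy_convergent_iff convergent_def by blast
  have lim: "(\<lambda>n. blinfun_apply (blinfun_of_cdual (X n)) x) \<longlonglongrightarrow> blinfun_apply L x" for x
    by (intro tendsto_intros L)
  have "blinfun_apply L (c *\<^sub>C x) = c * blinfun_apply L x" for c x
  proof (rule LIMSEQ_unique[OF lim])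
    have "(\<lambda>n. c * blinfun_apply (blinfun_of_cdual (X n)) x) \<longlonglongrightarrow> c * blinfun_apply L x"
      by (intro tendsto_intros lim)
    then show "(\<lambda>n. blinfun_apply (blinfun_of_cdual (X n)) (c *\<^sub>C x)) \<longlonglongrightarrow> c * blinfun_apply L x"
      using blinfun_of_cdual[of "X _"] by simp
  qed
  then have "blinfun_of_cdual (Abs_cdual L) = L"
    by (intro Abs_cdual_inverse) simp
  then have "X \<longlonglongrightarrow> Abs_cdual L"
    using L by (simp add: tendsto_iff dist_eq)
  then show "convergent X"
    by (auto simp: convergent_def)
qed


section \<open>Banach modules\<close>

definition bounded_cbilinear ::
  "('a::complex_normed_vector \<Rightarrow> 'b::complex_normed_vector \<Rightarrow> 'c::complex_normed_vector) \<Rightarrow> bool"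
  where "bounded_cbilinear f \<longleftrightarrow>
    (\<forall>y. clinear (\<lambda>x. f x y)) \<and> (\<forall>x. clinear (f x)) \<and>
    (\<exists>K. \<forall>x y. norm (f x y) \<le> K * norm x * norm y)"

definition banach_left_module :: "('a::complex_banach_algebra \<Rightarrow> 'x::complex_banach \<Rightarrow> 'x) \<Rightarrow> bool"
  where "banach_left_module lact \<longleftrightarrow>
    bounded_cbilinear lact \<and> (\<forall>a b x. lact (a * b) x = lact a (lact b x))"

definition banach_right_module :: "('x::complex_banach \<Rightarrow> 'a::complex_banach_algebra \<Rightarrow> 'x) \<Rightarrow> bool"
  where "banach_right_module ract \<longleftrightarrow>
    bounded_cbilinear ract \<and> (\<forall>a b x. ract x (a * b) = ract (ract x a) b)"

definition banach_bimodule ::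
  "('a::complex_banach_algebra \<Rightarrow> 'x::complex_banach \<Rightarrow> 'x) \<Rightarrow> ('x \<Rightarrow> 'a \<Rightarrow> 'x) \<Rightarrow> bool"
  where "banach_bimodule lact ract \<longleftrightarrow>
    banach_left_module lact \<and> banach_right_module ract \<and>
    (\<forall>a x b. ract (lact a x) b = lact a (ract x b))"

text \<open>The left dual action, \<open>(a f)(b) = f (b a)\<close>.\<close>

lift_definition dual_lact :: "'a::complex_banach_algebra \<Rightarrow> 'a cdual \<Rightarrow> 'a cdual"
  is "\<lambda>a f. blinfun_compose f (blinfun_mult_left a)"
  by (simp add: mult_scaleC_left)

lemma cdual_apply_dual_lact: "cdual_apply (dual_lact a f) b = cdual_apply f (b * a)"
  by transfer simp

lemma banach_left_module_mult: "banach_left_module ((*) :: 'a::complex_banach_algebra \<Rightarrow> _)"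
  unfolding banach_left_module_def bounded_cbilinear_def clinear_def
  by (auto simp: algebra_simps mult_scaleC_left mult_scaleC_right
      intro!: exI[of _ 1] norm_mult_ineq)

lemma banach_left_module_dual_lact:
  "banach_left_module (dual_lact :: 'a::complex_banach_algebra \<Rightarrow> _)"
proof -
  have "norm (dual_lact a f) \<le> norm f * norm a" for a :: 'a and f
  proof transfer
    fix a :: 'a and f :: "'a \<Rightarrow>\<^sub>L complex"
    have "norm (blinfun_apply f (b * a)) \<le> norm f * norm a * norm b" for b
    proof -
      have "norm (blinfun_apply f (b * a)) \<le> norm f * norm (b * a)"
        by (rule norm_blinfun)
      also have "\<dots> \<le> norm f * (norm b * norm a)"
        by (intro mult_left_mono norm_mult_ineq) simp
      finally show ?thesis
        by (simp add: mult_ac)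
    qed
    then show "norm (f o\<^sub>L blinfun_mult_left a) \<le> norm f * norm a"
      by (intro norm_blinfun_bound) auto
  qed
  moreover have "dual_lact (a + b) f = dual_lact a f + dual_lact b f"
    "dual_lact a (f + g) = dual_lact a f + dual_lact a g"
    "dual_lact (c *\<^sub>C a) f = c *\<^sub>C dual_lact a f"
    "dual_lact a (c *\<^sub>C f) = c *\<^sub>C dual_lact a f"
    "dual_lact (a * b) f = dual_lact a (dual_lact b f)" for a b :: 'a and f g c
    by (transfer, force intro: blinfun_eqI
        simp: blinfun.bilinear_simps algebra_simps mult_scaleC_right)+
  ultimately show ?thesis
    unfolding banach_left_module_def bounded_cbilinear_def clinear_def
    by (auto intro!: exI[of _ 1] simp: mult.commute)
qed


section \<open>Carrier space, semisimplicity, regularity\<close>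

text \<open>
  The Gelfand transform of \<open>a\<close> is \<open>\<lambda>\<phi>. \<phi> a\<close> on the carrier space.
  The topology of a function type in the library is that of pointwise convergence, so
  the Gelfand topology is the subspace topology \<open>top_of_set carrier_space\<close>.
\<close>

definition carrier_space :: "('a::complex_banach_algebra \<Rightarrow> complex) set"
  where "carrier_space =
    {\<phi>. clinear \<phi> \<and> (\<forall>a b. \<phi> (a * b) = \<phi> a * \<phi> b) \<and> \<phi> \<noteq> (\<lambda>_. 0)}"

definition ideal_hull :: "'a::complex_banach_algebra set \<Rightarrow> ('a \<Rightarrow> complex) set"
  where "ideal_hull I = {\<phi> \<in> carrier_space. \<forall>a\<in>I. \<phi> a = 0}"

definition regular_algebra :: "'a::comm_complex_banach_algebra itself \<Rightarrow> bool"
  where "regular_algebra TYPE('a) \<longleftrightarrow>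
    (\<forall>F (\<phi> :: 'a \<Rightarrow> complex).
      closedin (top_of_set carrier_space) F \<and> \<phi> \<in> carrier_space - F \<longrightarrow>
      (\<exists>a. \<phi> a \<noteq> 0 \<and> (\<forall>\<psi>\<in>F. \<psi> a = 0)))"

definition algebra_ideal :: "'a::comm_complex_banach_algebra set \<Rightarrow> bool"
  where "algebra_ideal I \<longleftrightarrow>
    0 \<in> I \<and> (\<forall>x\<in>I. \<forall>y\<in>I. x + y \<in> I) \<and> (\<forall>c. \<forall>x\<in>I. c *\<^sub>C x \<in> I) \<and> (\<forall>a. \<forall>x\<in>I. a * x \<in> I)"

definition maximal_modular_ideal :: "'a::comm_complex_banach_algebra set \<Rightarrow> bool"
  where "maximal_modular_ideal M \<longleftrightarrow>
    algebra_ideal M \<and> M \<noteq> UNIV \<and> (\<exists>u. \<forall>a. a - u * a \<in> M) \<and>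
    (\<forall>J. algebra_ideal J \<and> M \<subseteq> J \<longrightarrow> J = M \<or> J = UNIV)"

text \<open>
  The radical is the intersection of the maximal modular ideals (the whole algebra if there
  are none).
\<close>

definition semisimple_algebra :: "'a::comm_complex_banach_algebra itself \<Rightarrow> bool"
  where "semisimple_algebra TYPE('a) \<longleftrightarrow> \<Inter> {M :: 'a set. maximal_modular_ideal M} = {0}"


section \<open>Local operators and hyper-Tauberian algebras\<close>

definition annihilator :: "('a \<Rightarrow> 'x \<Rightarrow> 'x::zero) \<Rightarrow> 'x \<Rightarrow> 'a set"
  where "annihilator act x = {a. act a x = 0}"

definition supp :: "('a::complex_banach_algebra \<Rightarrow> 'x \<Rightarrow> 'x::zero) \<Rightarrow> 'x \<Rightarrow> ('a \<Rightarrow> complex) set"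
  where "supp act x = ideal_hull (annihilator act x)"

text \<open>A linear \<open>T\<close> between left modules with the actions \<open>actX\<close> and \<open>actY\<close>.\<close>

definition local_operator ::
  "('a::complex_banach_algebra \<Rightarrow> 'x \<Rightarrow> 'x) \<Rightarrow> ('a \<Rightarrow> 'y \<Rightarrow> 'y) \<Rightarrow>
    ('x::complex_banach \<Rightarrow> 'y::complex_banach) \<Rightarrow> bool"
  where "local_operator actX actY T \<longleftrightarrow>
    clinear T \<and> (\<forall>x. supp actY (T x) \<subseteq> supp actX x)"

definition hyper_tauberian :: "'a::comm_complex_banach_algebra itself \<Rightarrow> bool"
  where "hyper_tauberian TYPE('a) \<longleftrightarrow>
    regular_algebra TYPE('a) \<and> semisimple_algebra TYPE('a) \<and>
    (\<forall>T :: 'a \<Rightarrow> 'a cdual.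
      bounded_clinear T \<and> local_operator (*) dual_lact T \<longrightarrow>
      (\<forall>a b. T (a * b) = dual_lact a (T b)))"


section \<open>Cocycles\<close>

text \<open>
  A map on the \<open>n\<close>-fold product of \<open>A\<close> is represented by a function on lists, of which only
  the values on lists of length \<open>n\<close> matter. The list \<open>[a\<^sub>1, \<dots>, a\<^sub>n]\<close> is indexed from \<open>0\<close>,
  so \<open>a\<^sub>j\<close> is \<open>as ! (j - 1)\<close>.
\<close>

definition multilinear :: "nat \<Rightarrow> ('a::complex_normed_vector list \<Rightarrow> 'x::complex_normed_vector) \<Rightarrow> bool"
  where "multilinear n T \<longleftrightarrow>
    (\<forall>as i. length as = n \<and> i < n \<longrightarrow> clinear (\<lambda>a. T (as[i := a])))"

definition bounded_multilinear ::
  "nat \<Rightarrow> ('a::complex_normed_vector list \<Rightarrow> 'x::complex_normed_vector) \<Rightarrow> bool"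
  where "bounded_multilinear n T \<longleftrightarrow>
    multilinear n T \<and>
    (\<exists>K. \<forall>as. length as = n \<longrightarrow> norm (T as) \<le> K * (\<Prod>a\<leftarrow>as. norm a))"

definition coboundary ::
  "('a::complex_banach_algebra \<Rightarrow> 'x::complex_banach \<Rightarrow> 'x) \<Rightarrow> ('x \<Rightarrow> 'a \<Rightarrow> 'x) \<Rightarrow>
    nat \<Rightarrow> ('a list \<Rightarrow> 'x) \<Rightarrow> 'a list \<Rightarrow> 'x"
  where "coboundary lact ract n T as =
    lact (as ! 0) (T (drop 1 as))
    + (\<Sum>j = 1..n. (-1) ^ j *\<^sub>R
        T (take (j - 1) as @ [as ! (j - 1) * as ! j] @ drop (j + 1) as))
    + (-1) ^ (n + 1) *\<^sub>R ract (T (take n as)) (as ! n)"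

definition cocycle ::
  "('a::complex_banach_algebra \<Rightarrow> 'x::complex_banach \<Rightarrow> 'x) \<Rightarrow> ('x \<Rightarrow> 'a \<Rightarrow> 'x) \<Rightarrow>
    nat \<Rightarrow> ('a list \<Rightarrow> 'x) \<Rightarrow> bool"
  where "cocycle lact ract n T \<longleftrightarrow>
    multilinear n T \<and> (\<forall>as. length as = n + 1 \<longrightarrow> coboundary lact ract n T as = 0)"

definition local_cocycle ::
  "('a::complex_banach_algebra \<Rightarrow> 'x::complex_banach \<Rightarrow> 'x) \<Rightarrow> ('x \<Rightarrow> 'a \<Rightarrow> 'x) \<Rightarrow>
    nat \<Rightarrow> ('a list \<Rightarrow> 'x) \<Rightarrow> bool"
  where "local_cocycle lact ract n T \<longleftrightarrow>
    multilinear n T \<and>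
    (\<forall>as. length as = n \<longrightarrow> (\<exists>S. cocycle lact ract n S \<and> T as = S as))"

definition bounded_local_cocycle ::
  "('a::complex_banach_algebra \<Rightarrow> 'x::complex_banach \<Rightarrow> 'x) \<Rightarrow> ('x \<Rightarrow> 'a \<Rightarrow> 'x) \<Rightarrow>
    nat \<Rightarrow> ('a list \<Rightarrow> 'x) \<Rightarrow> bool"
  where "bounded_local_cocycle lact ract n T \<longleftrightarrow>
    local_cocycle lact ract n T \<and> bounded_multilinear n T"

end

(*
  In a hyper-Tauberian algebra A, a bounded bilinear map phi with phi(a,b) = 0 whenever ab = 0
  satisfies phi(ab,c) = phi(b,ca): the operator a |-> phi(a,.) is local. Rank one operators show
  moreover that ideals with empty hull are dense and that points are sets of spectral synthesis,
  from which one gets a dense ideal of elements b with eb = b for some e in A. Hence, over the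
  unitization U, a bounded bilinear phi vanishing on zero products satisfies phi(u,1) = phi(1,u).

  Cocycles on A extend to normalized cocycles on U (zero as soon as one argument is 1). If
  c_0 c_1 = c_1 c_2 = ... = c_n c_(n+1) = 0, the cocycle identity gives
  c_0 T(c_1,...,c_n) c_(n+1) = 0 for a cocycle T, hence for a local cocycle. The identity
  phi(u,1) = phi(1,u) removes the conditions on the products one at a time, each removal adding the
  next summand of the coboundary.
*)
theory Submission
  imports Defs
begin

section \<open>The Hahn-Banach theorem\<close>

text \<open>The cocycles that witness locality vary with the argument and may be unbounded, so no
  limit can be taken along them. Only one algebraic identity is transferred from them to the map,
  and continuity enters through the map itself. Removing a product condition means comparing a
  bilinear map with 1 in either slot; this is why a unit is adjoined. For normalized cochains, a 1
  in the critical slot collapses a truncated coboundary to a single term, the one that continues the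
  sum. The local units inside the algebra come without a norm bound: they cancel from the identity
  before density is used. Semisimplicity is given by maximal modular ideals; the characters
  belonging to these come from the density of ideals with empty hull, not from the Gelfand-Mazur
  theorem.\<close>

definition sublinear :: "('a::real_vector \<Rightarrow> real) \<Rightarrow> bool"
  where "sublinear p \<longleftrightarrow>
    (\<forall>x y. p (x + y) \<le> p x + p y) \<and> (\<forall>c x. 0 \<le> c \<longrightarrow> p (c *\<^sub>R x) = c * p x)"

lemma sublinear_add: "sublinear p \<Longrightarrow> p (x + y) \<le> p x + p y"
  and sublinear_scale: "sublinear p \<Longrightarrow> 0 \<le> c \<Longrightarrow> p (c *\<^sub>R x) = c * p x"
  by (auto simp: sublinear_def)

lemma sublinear_zero: "sublinear p \<Longrightarrow> p 0 = 0"
  using sublinear_scale[of p 0 0] by simp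

lemma sublinear_neg: "sublinear p \<Longrightarrow> - p (- x) \<le> p x"
  using sublinear_add[of p x "- x"] by (simp add: sublinear_zero)

text \<open>
  A sublinear functional below \<open>p\<close> that is exact in the direction \<open>y\<close>. A minimal sublinear
  functional therefore satisfies \<open>p (- y) = - p y\<close> for all \<open>y\<close>, and so it is linear.
\<close>

lemma sublinear_directional:
  assumes p: "sublinear p"
  obtains q where "sublinear q" "q \<le> p" "q (- y) \<le> - p y"
proof
  \<comment> \<open>Taking s = 0 will give \<open>q \<le> p\<close>, and s = 1 at \<open>- y\<close>
    gives the bound \<open>p 0 - p y\<close>.\<close>
  define g where "g x s = p (x + s *\<^sub>R y) - s * p y" for x s
  define q where "q x = (INF s\<in>{0..}. g x s)" for x
  have low: "- p (- x) \<le> g x s" if "0 \<le> s" for x s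
    using sublinear_add[OF p, of "x + s *\<^sub>R y" "- x"] sublinear_scale[OF p that, of y]
    by (simp add: g_def)
  have bdd: "bdd_below (g x ` {0..})" for x
    using low by (auto simp: bdd_below_def)
  have q_le: "q x \<le> g x s" if "0 \<le> s" for x s
    unfolding q_def using that by (intro cINF_lower bdd) auto
  have q_ge: "m \<le> q x" if "\<And>s. 0 \<le> s \<Longrightarrow> m \<le> g x s" for m x
    unfolding q_def using that by (intro cINF_greatest) auto
  have add: "q (x + x') \<le> q x + q x'" for x x'
  proof -
    have "q (x + x') - g x' s' \<le> q x" if s': "0 \<le> s'" for s'
    proof (rule q_ge)
      fix s :: real assume s: "0 \<le> s"
      have "q (x + x') \<le> g (x + x') (s + s')"
        using s s' by (intro q_le) simp
      also have "\<dots> \<le> g x s + g x' s'"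
        using sublinear_add[OF p, of "x + s *\<^sub>R y" "x' + s' *\<^sub>R y"]
        by (simp add: g_def algebra_simps)
      finally show "q (x + x') - g x' s' \<le> g x s" by simp
    qed
    then have "q (x + x') - q x \<le> q x'"
      by (intro q_ge) (simp add: algebra_simps)
    then show ?thesis by simp
  qed
  have le: "q (c *\<^sub>R x) \<le> c * q x" if c: "0 < c" for c x
  proof -
    have "q (c *\<^sub>R x) / c \<le> q x"
    proof (rule q_ge)
      fix s :: real assume s: "0 \<le> s"
      have "q (c *\<^sub>R x) \<le> g (c *\<^sub>R x) (c * s)"
        using c s by (intro q_le) simp
      also have "\<dots> = c * g x s"
        using c sublinear_scale[OF p, of c "x + s *\<^sub>R y"]
        by (simp add: g_def algebra_simps)
      finally show "q (c *\<^sub>R x) / c \<le> g x s" using c by (simp add: field_simps)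
    qed
    then show ?thesis using c by (simp add: field_simps)
  qed
  have zero: "q 0 = 0"
  proof (rule antisym)
    show "q 0 \<le> 0" using q_le[of 0 0] by (simp add: g_def sublinear_zero[OF p])
    show "0 \<le> q 0" by (intro q_ge) (simp add: g_def sublinear_scale[OF p])
  qed
  have scale: "q (c *\<^sub>R x) = c * q x" if "0 \<le> c" for c x
  proof (cases "c = 0")
    case False
    then have c: "0 < c" using that by simp
    have "q (inverse c *\<^sub>R (c *\<^sub>R x)) \<le> inverse c * q (c *\<^sub>R x)"
      using c by (intro le) simp
    then have "c * q x \<le> q (c *\<^sub>R x)" using c by (simp add: field_simps)
    then show ?thesis using le[OF c] by (simp add: antisym)
  qed (simp add: zero)
  show "sublinear q" using add scale by (simp add: sublinear_def)
  show "q \<le> p"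
    using q_le[of 0] by (auto simp: le_fun_def g_def)
  show "q (- y) \<le> - p y"
    using q_le[of 1 "- y"] by (simp add: g_def sublinear_zero[OF p])
qed

text \<open>Zorn's lemma for the reversed pointwise order. The infimum of a chain is finite because
  every member stays above \<open>- p (- x)\<close>, and subadditive because any two members lie
  above a common one.\<close>

lemma sublinear_minimal:
  assumes p: "sublinear p"
  obtains q where "sublinear q" "q \<le> p" "\<And>r. sublinear r \<Longrightarrow> r \<le> q \<Longrightarrow> r = q"
proof -
  define A where "A = {q. sublinear q \<and> q \<le> p}"
  have "\<exists>m\<in>A. \<forall>a\<in>A. m \<ge> a \<longrightarrow> a = m"
  proof (rule predicate_Zorn)
    show "partial_order_on A (relation_of (\<ge>) A)"
      by (auto intro!: partial_order_on_relation_ofI)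
    fix C assume C: "C \<in> Chains (relation_of (\<ge>) A)"
    then have CA: "C \<subseteq> A" by (auto simp: Chains_def relation_of_def)
    have tot: "q \<le> r \<or> r \<le> q" if "q \<in> C" "r \<in> C" for q r
      using C that by (auto simp: Chains_def relation_of_def)
    show "\<exists>u\<in>A. \<forall>a\<in>C. a \<ge> u"
    proof (cases "C = {}")
      case True
      then show ?thesis using p by (auto simp: A_def)
    next
      case False
      define u where "u x = (INF q\<in>C. q x)" for x
      have low: "- p (- x) \<le> q x" if "q \<in> C" for q x
      proof -
        have q: "sublinear q" "q (- x) \<le> p (- x)"
          using that CA by (auto simp: A_def le_fun_def)
        then show ?thesis using sublinear_neg[of q x] by simp
      qed
      have bdd: "bdd_below ((\<lambda>q. q x) ` C)" for x
        using low by (auto simp: bdd_below_def)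
      have u_le: "u x \<le> q x" if "q \<in> C" for q x
        unfolding u_def using that by (intro cINF_lower bdd)
      have u_ge: "m \<le> u x" if "\<And>q. q \<in> C \<Longrightarrow> m \<le> q x" for m x
        unfolding u_def using that False by (intro cINF_greatest) auto
      have add: "u (x + y) \<le> u x + u y" for x y
      proof -
        have "u (x + y) - r y \<le> u x" if r: "r \<in> C" for r
        proof (rule u_ge)
          fix q assume q: "q \<in> C"
          obtain s where s: "s \<in> C" "s \<le> q" "s \<le> r"
            using tot[OF q r] q r by blast
          then have "sublinear s" using CA by (auto simp: A_def)
          then have "u (x + y) \<le> s x + s y"
            using u_le[OF s(1), of "x + y"] sublinear_add[of s x y] by simp
          also have "\<dots> \<le> q x + r y"
            using s by (intro add_mono) (auto simp: le_fun_def)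
          finally show "u (x + y) - r y \<le> q x" by simp
        qed
        then have "u (x + y) - u x \<le> u y"
          by (intro u_ge) (simp add: algebra_simps)
        then show ?thesis by simp
      qed
      have scale: "u (c *\<^sub>R x) = c * u x" if c: "0 \<le> c" for c x
      proof -
        have C: "q (c *\<^sub>R x) = c * q x" if "q \<in> C" for q
          using that CA c by (auto simp: A_def sublinear_scale)
        show ?thesis
        proof (cases "c = 0")
          case True
          then show ?thesis using C u_ge[of 0 0] u_le[of _ 0] False
            by (force intro: antisym)
        next
          case False
          then have c: "0 < c" using c by simp
          show ?thesis
          proof (rule antisym)
            have "u (c *\<^sub>R x) / c \<le> u x"
            proof (rule u_ge)
              fix q assume "q \<in> C"
              then show "u (c *\<^sub>R x) / c \<le> q x"
                using u_le[of q "c *\<^sub>R x"] C[of q] c by (simp add: field_simps)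
            qed
            then show "u (c *\<^sub>R x) \<le> c * u x" using c by (simp add: field_simps)
            show "c * u x \<le> u (c *\<^sub>R x)"
            proof (rule u_ge)
              fix q assume "q \<in> C"
              then show "c * u x \<le> q (c *\<^sub>R x)"
                using u_le[of q x] C[of q] c by simp
            qed
          qed
        qed
      qed
      obtain q where "q \<in> C" using False by blast
      then have "u \<le> p" using u_le[of q] CA
        by (intro le_funI) (metis (no_types, lifting) A_def le_funD mem_Collect_eq order_trans subsetD)
      then have "u \<in> A" using add scale by (simp add: A_def sublinear_def)
      then show ?thesis using u_le by (auto simp: le_fun_def)
    qed
  qed
  then obtain q where "q \<in> A" and min: "\<And>r. r \<in> A \<Longrightarrow> r \<le> q \<Longrightarrow> r = q" by blast
  then show thesis by (intro that[of q]) (auto simp: A_def)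
qed

text \<open>The directional lemma is used twice: at \<open>x0\<close>, to force the value
  \<open>p x0\<close>, and below the minimal functional, to make it odd.\<close>

theorem Hahn_Banach_sublinear:
  assumes p: "sublinear p"
  obtains f where "linear f" "f \<le> p" "f x0 = p x0"
proof -
  obtain p' where p': "sublinear p'" "p' \<le> p" "p' (- x0) \<le> - p x0"
    using sublinear_directional[OF p] by blast
  obtain f where f: "sublinear f" "f \<le> p'" and min: "\<And>r. sublinear r \<Longrightarrow> r \<le> f \<Longrightarrow> r = f"
    using sublinear_minimal[OF p'(1)] by blast
  have neg: "f (- y) = - f y" for y
  proof -
    obtain q where "sublinear q" "q \<le> f" "q (- y) \<le> - f y"
      using sublinear_directional[OF f(1)] by blast
    then have "f (- y) \<le> - f y" using min by blast
    then show ?thesis using sublinear_neg[OF f(1), of y] by simp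
  qed
  have add: "f (x + y) = f x + f y" for x y
    using sublinear_add[OF f(1), of x y] sublinear_add[OF f(1), of "x + y" "- y"] neg[of y]
    by simp
  have scale: "f (c *\<^sub>R x) = c * f x" for c x
    using sublinear_scale[OF f(1), of c x] sublinear_scale[OF f(1), of "- c" x] neg[of "c *\<^sub>R x"]
    by (cases "0 \<le> c") auto
  have le: "f x \<le> p x" for x
    using f(2) p'(2) by (auto simp: le_fun_def intro: order_trans)
  have "- f x0 \<le> - p x0"
    using le_funD[OF f(2), of "- x0"] p'(3) neg[of x0] by simp
  then show thesis using le[of x0] add scale le
    by (intro that[of f]) (auto simp: le_fun_def intro!: linearI)
qed

section \<open>Complex-linear maps and functionals\<close>

lemma clinear_add: "clinear f \<Longrightarrow> f (x + y) = f x + f y"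
  and clinear_scaleC: "clinear f \<Longrightarrow> f (c *\<^sub>C x) = c *\<^sub>C f x"
  by (auto simp: clinear_def)

lemma clinear_zero: "clinear f \<Longrightarrow> f 0 = 0"
  using clinear_add[of f 0 0] by simp

lemma clinear_neg: "clinear f \<Longrightarrow> f (- x) = - f x"
  using clinear_add[of f x "- x"] by (simp add: clinear_zero minus_unique)

lemma clinear_diff: "clinear f \<Longrightarrow> f (x - y) = f x - f y"
  using clinear_add[of f x "- y"] by (simp add: clinear_neg)

lemma scaleC_complex [simp]: "(c *\<^sub>C x :: complex) = c * x"
  by (simp add: scaleC_complex_def)

lemma clinear_scaleR:
  assumes "clinear f" shows "f (r *\<^sub>R x) = r *\<^sub>R f x"
  using clinear_scaleC[OF assms, of "complex_of_real r" x] by (simp add: scaleC_of_real)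

lemma scaleC_one [simp]: "1 *\<^sub>C x = x"
  using scaleC_of_real[of 1 x] by simp

lemma scaleC_zero_left [simp]: "0 *\<^sub>C x = 0"
  using scaleC_of_real[of 0 x] by simp

lemma scaleC_zero_right [simp]: "c *\<^sub>C 0 = 0"
  using scaleC_add_right[of c 0 0] by simp

lemma bounded_clinear_imp_bounded_linear:
  assumes "bounded_clinear f" shows "bounded_linear f"
proof -
  from assms obtain K where lin: "clinear f" and K: "\<And>x. norm (f x) \<le> K * norm x"
    by (auto simp: bounded_clinear_def)
  show ?thesis
    using K by (intro bounded_linear_intro[where K = K])
      (auto simp: clinear_add[OF lin] clinear_scaleR[OF lin] mult.commute)
qed

lemma clinear_cdual_apply: "clinear (cdual_apply f)"
  unfolding clinear_def by transfer (simp add: blinfun.add_right)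

lemma norm_cdual_apply: "norm (cdual_apply f x) \<le> norm f * norm x"
  by transfer (rule norm_blinfun)

lemma bounded_clinear_cdual_apply: "bounded_clinear (cdual_apply f)"
  unfolding bounded_clinear_def using clinear_cdual_apply norm_cdual_apply by blast

lemma cdual_eqI: "(\<And>x. cdual_apply f x = cdual_apply g x) \<Longrightarrow> f = g"
  by transfer (rule blinfun_eqI)

lemma cdual_apply_add: "cdual_apply (f + g) x = cdual_apply f x + cdual_apply g x"
  by transfer (simp add: blinfun.add_left)

lemma cdual_apply_scaleC: "cdual_apply (c *\<^sub>C f) x = c * cdual_apply f x"
  by transfer simp

lemma cdual_apply_zero [simp]: "cdual_apply 0 x = 0"
  by transfer simp

lemma norm_cdual_le:
  assumes "0 \<le> K" "\<And>x. norm (cdual_apply f x) \<le> K * norm x"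
  shows "norm f \<le> K"
  using assms by transfer (rule norm_blinfun_bound)

lemma bounded_clinear_cdualE:
  fixes F :: "'a::complex_normed_vector \<Rightarrow> complex"
  assumes "bounded_clinear F"
  obtains f where "cdual_apply f = F"
proof
  have bl: "bounded_linear F" using assms by (rule bounded_clinear_imp_bounded_linear)
  have lin: "clinear F" using assms by (simp add: bounded_clinear_def)
  have "blinfun_of_cdual (Abs_cdual (Blinfun F)) = Blinfun F"
    by (intro Abs_cdual_inverse) (simp add: bounded_linear_Blinfun_apply[OF bl] clinear_scaleC[OF lin])
  then show "cdual_apply (Abs_cdual (Blinfun F)) = F"
    by (simp add: cdual_apply.rep_eq bounded_linear_Blinfun_apply[OF bl])
qed

definition csubspace :: "'a::complex_normed_vector set \<Rightarrow> bool"
  where "csubspace V \<longleftrightarrow> 0 \<in> V \<and> (\<forall>x\<in>V. \<forall>y\<in>V. x + y \<in> V) \<and> (\<forall>c. \<forall>x\<in>V. c *\<^sub>C x \<in> V)"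

text \<open>Supplies the dominating functional for separation: a linear map below the distance
  vanishes on \<open>V\<close>, is bounded by the norm, and can attain the distance at a chosen
  point.\<close>

lemma sublinear_infdist:
  assumes V: "csubspace V" shows "sublinear (\<lambda>x. infdist x V)"
proof -
  have ne: "V \<noteq> {}" and add: "\<And>x y. x \<in> V \<Longrightarrow> y \<in> V \<Longrightarrow> x + y \<in> V"
    and zero: "0 \<in> V" and sc: "\<And>r x. x \<in> V \<Longrightarrow> r *\<^sub>R x \<in> V"
    using V by (auto simp: csubspace_def scaleC_of_real[symmetric])
  have ge: "m \<le> infdist x V" if "\<And>v. v \<in> V \<Longrightarrow> m \<le> dist x v" for m x
    using ne that by (auto simp: infdist_def intro: cINF_greatest)
  have tri: "infdist (x + y) V \<le> infdist x V + infdist y V" for x y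
  proof -
    have "infdist (x + y) V - dist y w \<le> infdist x V" if w: "w \<in> V" for w
    proof (rule ge)
      fix v assume "v \<in> V"
      then have "infdist (x + y) V \<le> dist (x + y) (v + w)"
        using w by (intro infdist_le add)
      also have "\<dots> \<le> dist x v + dist y w" by (rule dist_triangle_add)
      finally show "infdist (x + y) V - dist y w \<le> dist x v" by simp
    qed
    then have "infdist (x + y) V - infdist x V \<le> infdist y V"
      by (intro ge) (simp add: algebra_simps)
    then show ?thesis by simp
  qed
  have le: "infdist (c *\<^sub>R x) V \<le> c * infdist x V" if c: "0 < c" for c x
  proof -
    have "infdist (c *\<^sub>R x) V / c \<le> infdist x V"
    proof (rule ge)
      fix v assume "v \<in> V"
      then have "infdist (c *\<^sub>R x) V \<le> dist (c *\<^sub>R x) (c *\<^sub>R v)" by (intro infdist_le sc)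
      also have "\<dots> = c * dist x v"
        using c by (simp add: dist_norm scaleR_diff_right[symmetric])
      finally show "infdist (c *\<^sub>R x) V / c \<le> dist x v" using c by (simp add: field_simps)
    qed
    then show ?thesis using c by (simp add: field_simps)
  qed
  have "infdist (c *\<^sub>R x) V = c * infdist x V" if "0 \<le> c" for c x
  proof (cases "c = 0")
    case False
    then have c: "0 < c" using that by simp
    have "infdist (inverse c *\<^sub>R (c *\<^sub>R x)) V \<le> inverse c * infdist (c *\<^sub>R x) V"
      using c by (intro le) simp
    then have "c * infdist x V \<le> infdist (c *\<^sub>R x) V" using c by (simp add: field_simps)
    then show ?thesis using le[OF c] by (simp add: antisym)
  qed (use zero in simp)
  then show ?thesis using tri by (simp add: sublinear_def)
qed

text \<open>The real functional attaining the distance at \<open>x0\<close> is complexified as f x -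
  i f (i x). As \<open>V\<close> is a complex subspace, i v stays in \<open>V\<close>, so both parts
  vanish there.\<close>

theorem Hahn_Banach_separation:
  fixes V :: "'a::complex_normed_vector set"
  assumes V: "csubspace V" and x0: "x0 \<notin> closure V"
  obtains f where "\<And>v. v \<in> V \<Longrightarrow> cdual_apply f v = 0" "cdual_apply f x0 \<noteq> 0"
proof -
  obtain f where f: "linear f" "f \<le> (\<lambda>x. infdist x V)" "f x0 = infdist x0 V"
    using Hahn_Banach_sublinear[OF sublinear_infdist[OF V]] by blast
  have V0: "0 \<in> V" and Vsc: "\<And>c v. v \<in> V \<Longrightarrow> c *\<^sub>C v \<in> V" using V by (auto simp: csubspace_def)
  have le: "\<bar>f x\<bar> \<le> infdist x V" for x
  proof -
    have "infdist (- x) V \<le> infdist x V"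
    proof -
      have "infdist (- x) V \<le> dist x v" if "v \<in> V" for v
        using Vsc[OF that, of "- 1"] infdist_le[of "- v" V "- x"] scaleC_of_real[of "-1" v]
        by (simp add: dist_norm norm_minus_commute)
      then show ?thesis using V0 by (subst (2) infdist_def) (auto intro!: cINF_greatest)
    qed
    moreover have "f x \<le> infdist x V" "f (- x) \<le> infdist (- x) V"
      using f(2) by (auto simp: le_fun_def)
    ultimately show ?thesis using linear_neg[OF f(1), of x] by linarith
  qed
  have le_norm: "\<bar>f x\<bar> \<le> norm x" for x
    using le[of x] infdist_le[OF V0, of x] by simp
  have add: "f (x + y) = f x + f y" and sc: "f (r *\<^sub>R x) = r * f x" for x y r
    using f(1) by (auto simp: linear_add linear_scale)
  define F where "F x = Complex (f x) (- f (\<i> *\<^sub>C x))" for x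
  have split: "f (c *\<^sub>C x) = Re c * f x + Im c * f (\<i> *\<^sub>C x)" for c x
  proof -
    have "c *\<^sub>C x = (complex_of_real (Re c)) *\<^sub>C x + (complex_of_real (Im c)) *\<^sub>C (\<i> *\<^sub>C x)"
      by (simp add: scaleC_scaleC scaleC_add_left[symmetric] complex_eq[symmetric] mult.commute)
    then show ?thesis by (simp add: scaleC_of_real add sc)
  qed
  have "clinear F"
    unfolding clinear_def
  proof (intro conjI allI)
    show "F (x + y) = F x + F y" for x y
      by (simp add: F_def scaleC_add_right add complex_eq_iff)
    show "F (c *\<^sub>C x) = c *\<^sub>C F x" for c x
    proof -
      have "f (\<i> *\<^sub>C c *\<^sub>C x) = - Im c * f x + Re c * f (\<i> *\<^sub>C x)"
        using split[of "\<i> * c" x] by (simp add: scaleC_scaleC)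
      then show ?thesis
        by (simp add: F_def complex_eq_iff split[of c x])
    qed
  qed
  moreover have "norm (F x) \<le> 2 * norm x" for x
    using cmod_le[of "F x"] le_norm[of x] le_norm[of "\<i> *\<^sub>C x"] by (simp add: F_def norm_scaleC)
  ultimately have "bounded_clinear F" by (auto simp: bounded_clinear_def)
  then obtain \<phi> where \<phi>: "cdual_apply \<phi> = F" by (rule bounded_clinear_cdualE)
  show thesis
  proof (rule that[of \<phi>])
    fix v assume "v \<in> V"
    then have "f v = 0" "f (\<i> *\<^sub>C v) = 0"
      using le[of v] le[of "\<i> *\<^sub>C v"] Vsc[of v \<i>] by auto
    then show "cdual_apply \<phi> v = 0" by (simp add: \<phi> F_def complex_eq_iff)
  next
    have "infdist x0 V \<noteq> 0" using x0 V0 in_closure_iff_infdist_zero[of V x0] by auto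
    then show "cdual_apply \<phi> x0 \<noteq> 0" by (simp add: \<phi> F_def f(3) complex_eq_iff)
  qed
qed

lemma cdual_separates:
  fixes x :: "'a::complex_normed_vector"
  assumes "\<And>f. cdual_apply f x = 0"
  shows "x = 0"
proof (rule ccontr)
  assume "x \<noteq> 0"
  then have "x \<notin> closure {0}" by simp
  moreover have "csubspace {0::'a}" by (simp add: csubspace_def)
  ultimately obtain f where "cdual_apply f x \<noteq> 0" by (metis Hahn_Banach_separation)
  then show False using assms by simp
qed

section \<open>Bounded bilinear maps and their composites\<close>

lemma bounded_cbilinearD:
  assumes "bounded_cbilinear \<phi>"
  shows "clinear (\<lambda>x. \<phi> x y)" "clinear (\<phi> x)"
  using assms by (auto simp: bounded_cbilinear_def)

lemma bounded_cbilinear_bound: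
  assumes "bounded_cbilinear \<phi>"
  shows "\<exists>K\<ge>0. \<forall>x y. norm (\<phi> x y) \<le> K * norm x * norm y"
proof -
  obtain K where K: "\<And>x y. norm (\<phi> x y) \<le> K * norm x * norm y"
    using assms by (auto simp: bounded_cbilinear_def)
  have "norm (\<phi> x y) \<le> max K 0 * norm x * norm y" for x y
    using K[of x y] mult_right_mono[of K "max K 0" "norm x * norm y"] by (simp add: mult.assoc)
  then show ?thesis by (intro exI[of _ "max K 0"]) simp
qed

lemma bounded_clinear_fix_right:
  assumes "bounded_cbilinear \<phi>" shows "bounded_clinear (\<lambda>x. \<phi> x y)"
proof -
  obtain K where "0 \<le> K" and "\<And>x y. norm (\<phi> x y) \<le> K * norm x * norm y"
    using bounded_cbilinear_bound[OF assms] by blast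
  then have "norm (\<phi> x y) \<le> (K * norm y) * norm x" for x by (simp add: mult_ac)
  then show ?thesis using bounded_cbilinearD(1)[OF assms]
    unfolding bounded_clinear_def by (intro conjI exI allI)
qed

lemma bounded_clinear_fix_left:
  assumes "bounded_cbilinear \<phi>" shows "bounded_clinear (\<phi> x)"
proof -
  obtain K where "0 \<le> K" and "\<And>x y. norm (\<phi> x y) \<le> K * norm x * norm y"
    using bounded_cbilinear_bound[OF assms] by blast
  then have "norm (\<phi> x y) \<le> (K * norm x) * norm y" for y by simp
  then show ?thesis using bounded_cbilinearD(2)[OF assms]
    unfolding bounded_clinear_def by (intro conjI exI allI)
qed

lemma bounded_clinear_compose:
  assumes f: "bounded_clinear f" and g: "bounded_clinear g"
  shows "bounded_clinear (\<lambda>x. f (g x))"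
proof -
  have "bounded_linear (\<lambda>x. f (g x))"
    using f g by (intro bounded_linear_compose[of f g] bounded_clinear_imp_bounded_linear)
  then have "\<exists>K. \<forall>x. norm (f (g x)) \<le> K * norm x"
    by (metis bounded_linear.bounded mult.commute)
  moreover have "clinear (\<lambda>x. f (g x))"
    using f g by (auto simp: bounded_clinear_def clinear_def)
  ultimately show ?thesis by (simp add: bounded_clinear_def)
qed

lemma bounded_cbilinear_compose:
  assumes l: "bounded_clinear l" and \<phi>: "bounded_cbilinear \<phi>"
    and f: "bounded_clinear f" and g: "bounded_clinear g"
  shows "bounded_cbilinear (\<lambda>x y. l (\<phi> (f x) (g y)))"
  unfolding bounded_cbilinear_def
proof (intro conjI allI)
  show "clinear (\<lambda>x. l (\<phi> (f x) (g y)))" for y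
    using l f bounded_cbilinearD(1)[OF \<phi>, of "g y"] by (auto simp: bounded_clinear_def clinear_def)
  show "clinear (\<lambda>y. l (\<phi> (f x) (g y)))" for x
    using l g bounded_cbilinearD(2)[OF \<phi>, of "f x"] by (auto simp: bounded_clinear_def clinear_def)
  obtain K where K: "0 \<le> K" "\<And>x y. norm (\<phi> x y) \<le> K * norm x * norm y"
    using bounded_cbilinear_bound[OF \<phi>] by blast
  obtain L F G where L: "\<And>x. norm (l x) \<le> norm x * L" "0 \<le> L"
    and F: "\<And>x. norm (f x) \<le> norm x * F" "0 \<le> F" and G: "\<And>x. norm (g x) \<le> norm x * G" "0 \<le> G"
    using l f g bounded_clinear_imp_bounded_linear bounded_linear.nonneg_bounded by metis
  have "norm (l (\<phi> (f x) (g y))) \<le> (L * K * F * G) * norm x * norm y" for x y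
  proof -
    have "norm (l (\<phi> (f x) (g y))) \<le> (K * norm (f x) * norm (g y)) * L"
      using L K(2) order_trans mult_right_mono by meson
    also have "\<dots> \<le> (K * (norm x * F) * (norm y * G)) * L"
      using K F G L by (intro mult_right_mono mult_mono mult_left_mono mult_nonneg_nonneg) auto
    finally show ?thesis by (simp add: mult_ac)
  qed
  then show "\<exists>K. \<forall>x y. norm (l (\<phi> (f x) (g y))) \<le> K * norm x * norm y" by blast
qed

lemma bounded_clinear_ident: "bounded_clinear (\<lambda>x. x)"
  unfolding bounded_clinear_def clinear_def by (auto intro: exI[of _ 1])

lemma bounded_clinear_mult_left: "bounded_clinear (\<lambda>x::'a::complex_banach_algebra. x * a)"
  and bounded_clinear_mult_right: "bounded_clinear (\<lambda>x::'a::complex_banach_algebra. a * x)"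
  unfolding bounded_clinear_def clinear_def
  by (auto simp: algebra_simps mult_scaleC_left mult_scaleC_right
      intro!: exI[of _ "norm a"] order_trans[OF norm_mult_ineq])

section \<open>Hyper-Tauberian algebras\<close>

text \<open>The form is viewed as the operator \<open>T\<close> sending \<open>a\<close> to
  \<open>\<phi> a\<close> in the dual. The set in \<open>loc\<close> is the annihilator of
  \<open>T a\<close> under the dual action, so \<open>loc\<close> is locality, and the multiplier
  identity evaluated at \<open>c\<close> is the conclusion.\<close>

lemma hyper_tauberian_local_form:
  fixes \<phi> :: "'a::comm_complex_banach_algebra \<Rightarrow> 'a \<Rightarrow> complex"
  assumes ht: "hyper_tauberian TYPE('a)" and \<phi>: "bounded_cbilinear \<phi>"
    and loc: "\<And>a. ideal_hull {c. \<forall>b. \<phi> a (b * c) = 0} \<subseteq> supp (*) a"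
  shows "\<phi> (a * b) c = \<phi> b (c * a)"
proof -
  have "\<exists>f. cdual_apply f = \<phi> a" for a
    by (rule bounded_clinear_cdualE[OF bounded_clinear_fix_left[OF \<phi>, of a]]) blast
  then obtain T where T: "\<And>a. cdual_apply (T a) = \<phi> a" by metis
  obtain K where K: "0 \<le> K" "\<And>x y. norm (\<phi> x y) \<le> K * norm x * norm y"
    using bounded_cbilinear_bound[OF \<phi>] by blast
  have lin: "clinear T"
    unfolding clinear_def
    using bounded_cbilinearD(1)[OF \<phi>]
    by (auto intro!: cdual_eqI simp: cdual_apply_add cdual_apply_scaleC T clinear_def)
  have "norm (T a) \<le> K * norm a" for a
    using K by (intro norm_cdual_le) (auto simp: T)
  then have bdd: "bounded_clinear T" using lin by (auto simp: bounded_clinear_def)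
  have "annihilator dual_lact (T a) = {c. \<forall>b. \<phi> a (b * c) = 0}" for a
  proof -
    have "dual_lact c (T a) = 0 \<longleftrightarrow> (\<forall>b. \<phi> a (b * c) = 0)" for c
    proof
      assume "dual_lact c (T a) = 0"
      then have "cdual_apply (dual_lact c (T a)) b = 0" for b by simp
      then show "\<forall>b. \<phi> a (b * c) = 0" by (simp add: cdual_apply_dual_lact T)
    qed (auto intro!: cdual_eqI simp: cdual_apply_dual_lact T)
    then show ?thesis by (auto simp: annihilator_def)
  qed
  then have "local_operator (*) dual_lact T"
    using lin loc by (simp add: local_operator_def supp_def)
  then have "T (a * b) = dual_lact a (T b)"
    using ht bdd by (auto simp: hyper_tauberian_def)
  then have "cdual_apply (T (a * b)) c = cdual_apply (dual_lact a (T b)) c" by simp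
  then show ?thesis by (simp add: cdual_apply_dual_lact T)
qed

lemma ideal_hull_antimono: "I \<subseteq> J \<Longrightarrow> ideal_hull J \<subseteq> ideal_hull I"
  by (auto simp: ideal_hull_def)

text \<open>Functionals reduce the claim to scalar forms. If c a = 0 then a (b c) = 0, so the
  annihilator of \<open>a\<close> kills the functional attached to \<open>a\<close>, and hulls
  reverse this inclusion.\<close>

lemma hyper_tauberian_zero_product:
  fixes \<phi> :: "'a::comm_complex_banach_algebra \<Rightarrow> 'a \<Rightarrow> 'x::complex_normed_vector"
  assumes ht: "hyper_tauberian TYPE('a)" and \<phi>: "bounded_cbilinear \<phi>"
    and zero: "\<And>a b. a * b = 0 \<Longrightarrow> \<phi> a b = 0"
  shows "\<phi> (a * b) c = \<phi> b (c * a)"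
proof -
  have "cdual_apply f (\<phi> (a * b) c) = cdual_apply f (\<phi> b (c * a))" for f
  proof (rule hyper_tauberian_local_form[OF ht])
    show "bounded_cbilinear (\<lambda>x y. cdual_apply f (\<phi> x y))"
      by (rule bounded_cbilinear_compose[OF bounded_clinear_cdual_apply \<phi>
            bounded_clinear_ident bounded_clinear_ident])
    show "ideal_hull {c. \<forall>b. cdual_apply f (\<phi> a (b * c)) = 0} \<subseteq> supp (*) a" for a
      unfolding supp_def
    proof (rule ideal_hull_antimono, rule subsetI)
      fix c assume "c \<in> annihilator (*) a"
      then have "c * a = 0" by (simp add: annihilator_def)
      then have "a * (b * c) = 0" for b by (metis mult.commute mult.left_commute mult_zero_right)
      then show "c \<in> {c. \<forall>b. cdual_apply f (\<phi> a (b * c)) = 0}"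
        by (simp add: zero clinear_zero[OF clinear_cdual_apply])
    qed
  qed
  then have "\<And>f. cdual_apply f (\<phi> (a * b) c - \<phi> b (c * a)) = 0"
    by (simp add: clinear_diff[OF clinear_cdual_apply])
  then have "\<phi> (a * b) c - \<phi> b (c * a) = 0"
    by (rule cdual_separates)
  then show ?thesis by simp
qed

text \<open>The case of the operator \<open>a \<mapsto> f(a) g\<close> of rank one.\<close>

lemma hyper_tauberian_rank_one:
  fixes f g :: "'a::comm_complex_banach_algebra \<Rightarrow> complex"
  assumes ht: "hyper_tauberian TYPE('a)" and f: "bounded_clinear f" and g: "bounded_clinear g"
    and loc: "\<And>a. f a \<noteq> 0 \<Longrightarrow> ideal_hull {c. \<forall>b. g (b * c) = 0} \<subseteq> supp (*) a"
  shows "f (a * b) * g c = f b * g (c * a)"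
proof (rule hyper_tauberian_local_form[OF ht, where \<phi> = "\<lambda>a b. f a * g b"])
  have "bounded_cbilinear ((*) :: complex \<Rightarrow> _)"
    using banach_left_module_mult[where 'a = complex] by (simp add: banach_left_module_def)
  then show "bounded_cbilinear (\<lambda>a b. f a * g b)"
    by (rule bounded_cbilinear_compose[OF bounded_clinear_ident _ f g])
  show "ideal_hull {c. \<forall>b. f a * g (b * c) = 0} \<subseteq> supp (*) a" for a
  proof (cases "f a = 0")
    case True
    \<comment> \<open>Here the set is the whole algebra, and a character is nonzero by definition;
      locality has content only where \<open>f a\<close> is nonzero.\<close>
    then have "ideal_hull {c. \<forall>b. f a * g (b * c) = 0} = {}"
      by (auto simp: ideal_hull_def carrier_space_def)
    then show ?thesis by simp
  next
    case False
    then show ?thesis using loc by simp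
  qed
qed

section \<open>Characters, and density of ideals with empty hull\<close>

lemma carrier_spaceD:
  assumes "t \<in> carrier_space"
  shows "clinear t" "t (a * b) = t a * t b" "\<exists>a. t a \<noteq> 0"
  using assms by (auto simp: carrier_space_def)

lemma carrier_space_obtain_one:
  assumes t: "t \<in> carrier_space" obtains a where "t a = 1"
proof -
  obtain a where "t a \<noteq> 0" using carrier_spaceD(3)[OF t] by blast
  then show thesis
    using clinear_scaleC[OF carrier_spaceD(1)[OF t], of "inverse (t a)" a] that by simp
qed

text \<open>In a unitization 1 + w would be the inverse of 1 - y; the equation says this without a
  unit and is solved as a fixed point of a contraction.\<close>

lemma quasi_inverse:
  fixes y :: "'a::comm_complex_banach_algebra"
  assumes "norm y < 1" obtains w where "w = y + y * w"
proof -
  have "dist (y + y * v) (y + y * w) \<le> norm y * dist v w" for v w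
    using norm_mult_ineq[of y "v - w"] by (simp add: dist_norm algebra_simps)
  then have "\<exists>!w. y + y * w = w"
    using assms by (intro banach_fix_type[of "norm y"]) auto
  then show thesis using that by metis
qed

text \<open>Otherwise a / t(a) is an element \<open>y\<close> of norm below 1 with t(y) = 1, and
  applying \<open>t\<close> to w = y + y w gives 0 = 1.\<close>

lemma carrier_space_contractive:
  fixes t :: "'a::comm_complex_banach_algebra \<Rightarrow> complex"
  assumes t: "t \<in> carrier_space" shows "norm (t a) \<le> norm a"
proof (rule ccontr)
  assume "\<not> norm (t a) \<le> norm a"
  then have lt: "norm a < norm (t a)" by simp
  note lin = carrier_spaceD(1)[OF t]
  define y where "y = inverse (t a) *\<^sub>C a"
  have ta: "t a \<noteq> 0" using lt by auto
  have "norm y < 1" using lt ta by (simp add: y_def norm_scaleC norm_inverse norm_divide field_simps)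
  then obtain w where "w = y + y * w" by (rule quasi_inverse)
  then have "t w = t y + t y * t w"
    by (metis carrier_spaceD(2)[OF t] clinear_add[OF lin])
  moreover have "t y = 1" using ta by (simp add: y_def clinear_scaleC[OF lin])
  ultimately show False by simp
qed

lemma bounded_clinear_carrier_space:
  fixes t :: "'a::comm_complex_banach_algebra \<Rightarrow> complex"
  assumes t: "t \<in> carrier_space" shows "bounded_clinear t"
  using carrier_spaceD(1)[OF t] carrier_space_contractive[OF t]
  by (auto simp: bounded_clinear_def intro!: exI[of _ 1])

lemma algebra_ideal_csubspace: "algebra_ideal I \<Longrightarrow> csubspace I"
  by (auto simp: algebra_ideal_def csubspace_def)

text \<open>
  If \<open>g\<close> annihilates the ideal, its support is empty and every operator \<open>a \<mapsto> f(a) g\<close> is local.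
  This forces multiplication by \<open>a\<close> to be a scalar \<open>\<mu>(a)\<close>, and \<open>\<mu>\<close> would be a
  point of the hull.
\<close>

theorem hyper_tauberian_ideal_dense:
  fixes I :: "'a::comm_complex_banach_algebra set"
  assumes ht: "hyper_tauberian TYPE('a)" and I: "algebra_ideal I" and hull: "ideal_hull I = {}"
  shows "closure I = UNIV"
proof (rule ccontr)
  assume "closure I \<noteq> UNIV"
  then obtain x where "x \<notin> closure I" by blast
  then obtain g where g: "\<And>i. i \<in> I \<Longrightarrow> cdual_apply g i = 0" and gx: "cdual_apply g x \<noteq> 0"
    using Hahn_Banach_separation[OF algebra_ideal_csubspace[OF I]] by metis
  \<comment> \<open>The rank one identity at c = x reads f (a b) g x = f b g (x a) for every
    functional f, so this quotient must be the scalar by which \<open>a\<close> acts.\<close>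
  define \<mu> where "\<mu> a = cdual_apply g (x * a) / cdual_apply g x" for a
  have Iabs: "a * i \<in> I" if "i \<in> I" for a i using I that by (simp add: algebra_ideal_def)
  have empty: "ideal_hull {c. \<forall>b. cdual_apply g (b * c) = 0} = {}"
    using ideal_hull_antimono[of I "{c. \<forall>b. cdual_apply g (b * c) = 0}"] g Iabs hull by blast
  have scalar: "a * b = \<mu> a *\<^sub>C b" for a b
  proof -
    have "cdual_apply f (a * b - \<mu> a *\<^sub>C b) = 0" for f
    proof -
      have "cdual_apply f (a * b) * cdual_apply g x = cdual_apply f b * cdual_apply g (x * a)"
        by (rule hyper_tauberian_rank_one[OF ht bounded_clinear_cdual_apply bounded_clinear_cdual_apply])
          (simp add: empty)
      then show ?thesis using gx
        by (simp add: clinear_diff[OF clinear_cdual_apply] clinear_scaleC[OF clinear_cdual_apply]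
            \<mu>_def field_simps)
    qed
    then have "a * b - \<mu> a *\<^sub>C b = 0" by (rule cdual_separates)
    then show ?thesis by simp
  qed
  have x0: "x \<noteq> 0" using gx clinear_zero[OF clinear_cdual_apply] by metis
  have lin: "clinear \<mu>"
    unfolding clinear_def
    by (auto simp: \<mu>_def distrib_left clinear_add[OF clinear_cdual_apply] add_divide_distrib
        mult_scaleC_right clinear_scaleC[OF clinear_cdual_apply])
  have mult: "\<mu> (a * b) = \<mu> a * \<mu> b" for a b
    using clinear_scaleC[OF lin] by (simp add: scalar)
  show False
  proof (cases "\<mu> = (\<lambda>_. 0)")
    case False
    then have "\<mu> \<in> carrier_space" using lin mult by (auto simp: carrier_space_def)
    moreover have "\<mu> i = 0" if "i \<in> I" for i
      using g[OF Iabs[OF that, of x]] by (simp add: \<mu>_def)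
    ultimately show False using hull by (auto simp: ideal_hull_def)
  next
    case True
    \<comment> \<open>With zero multiplication, modularity puts every a = a - u a into
      \<open>M\<close>, so there is no maximal modular ideal, the radical is everything, and
      semisimplicity leaves only 0.\<close>
    then have zero: "a * b = 0" for a b :: 'a by (simp add: scalar)
    have "\<not> maximal_modular_ideal M" for M :: "'a set"
      by (auto simp: maximal_modular_ideal_def zero)
    then have "(UNIV :: 'a set) = {0}"
      using ht by (simp add: hyper_tauberian_def semisimple_algebra_def)
    then show False using x0 by blast
  qed
qed

text \<open>The modular unit \<open>u\<close> has distance at least 1 from \<open>M\<close>, so
  \<open>M\<close> is not dense and its hull contains a character; maximality makes \<open>M\<close>
  the whole kernel.\<close>

lemma maximal_modular_ideal_kernel:
  fixes M :: "'a::comm_complex_banach_algebra set"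
  assumes ht: "hyper_tauberian TYPE('a)" and M: "maximal_modular_ideal M"
  obtains t where "t \<in> carrier_space" "M = {a. t a = 0}"
proof -
  have I: "algebra_ideal M" and proper: "M \<noteq> UNIV"
    and max: "\<And>J. algebra_ideal J \<Longrightarrow> M \<subseteq> J \<Longrightarrow> J = M \<or> J = UNIV"
    using M by (auto simp: maximal_modular_ideal_def)
  obtain u where u: "\<And>a. a - u * a \<in> M" using M by (auto simp: maximal_modular_ideal_def)
  have add: "\<And>a b. a \<in> M \<Longrightarrow> b \<in> M \<Longrightarrow> a + b \<in> M" and mult: "\<And>a b. b \<in> M \<Longrightarrow> a * b \<in> M"
    using I by (auto simp: algebra_ideal_def)
  have "u \<notin> closure M"
  proof
    assume "u \<in> closure M"
    then obtain m where m: "m \<in> M" "dist m u < 1"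
      using closure_approachable[of u M] zero_less_one by blast
    then have "norm (u - m) < 1" by (simp add: dist_norm norm_minus_commute)
    then obtain w where w: "w = (u - m) + (u - m) * w" by (rule quasi_inverse)
    \<comment> \<open>The equation for \<open>w\<close>, rearranged: the first bracket is in
      \<open>M\<close> by modularity, the second because \<open>m\<close> is.\<close>
    have "u = (w - u * w) + (w * m + m)"
    proof -
      have "w - u * w + (w * m + m) = (w - ((u - m) + (u - m) * w)) + u" by (simp add: algebra_simps)
      also have "\<dots> = u" using w by simp
      finally show ?thesis by simp
    qed
    then have "u \<in> M" using u[of w] m(1) by (metis add mult)
    then have "u * a \<in> M" for a using mult[of u a] by (simp add: mult.commute)
    then have "a \<in> M" for a using add[OF u[of a], of "u * a"] by simp
    then show False using proper by blast
  qed
  then have "ideal_hull M \<noteq> {}" using hyper_tauberian_ideal_dense[OF ht I] by blast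
  then obtain t where t: "t \<in> carrier_space" "\<And>a. a \<in> M \<Longrightarrow> t a = 0" by (auto simp: ideal_hull_def)
  note lin = carrier_spaceD(1)[OF t(1)]
  have "algebra_ideal {a. t a = 0}"
    by (simp add: algebra_ideal_def clinear_zero[OF lin] clinear_add[OF lin] clinear_scaleC[OF lin]
        carrier_spaceD(2)[OF t(1)])
  moreover have "{a. t a = 0} \<noteq> UNIV" using carrier_spaceD(3)[OF t(1)] by blast
  ultimately have "M = {a. t a = 0}" using max[of "{a. t a = 0}"] t(2) by blast
  then show thesis using t(1) that by blast
qed

text \<open>Semisimplicity turned into injectivity of the Gelfand transform, the form in which a
  product is shown to vanish.\<close>

lemma hyper_tauberian_carrier_space_separates:
  fixes a :: "'a::comm_complex_banach_algebra"
  assumes ht: "hyper_tauberian TYPE('a)" and "\<And>t. t \<in> carrier_space \<Longrightarrow> t a = 0"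
  shows "a = 0"
proof -
  have "a \<in> M" if "maximal_modular_ideal M" for M
  proof -
    obtain t where "t \<in> carrier_space" "M = {a. t a = 0}"
      using maximal_modular_ideal_kernel[OF ht \<open>maximal_modular_ideal M\<close>] .
    then show ?thesis using assms(2) by blast
  qed
  then have "a \<in> \<Inter> {M. maximal_modular_ideal M}" by blast
  moreover have "\<Inter> {M :: 'a set. maximal_modular_ideal M} = {0}"
    using ht by (simp add: hyper_tauberian_def semisimple_algebra_def)
  ultimately show ?thesis by blast
qed

text \<open>The values at \<open>a\<close> give disjoint neighbourhoods of the two characters. Their
  complements \<open>F s\<close> and \<open>F t\<close> are closed and cover the carrier space, so
  elements supplied by regularity, one vanishing on each, have product zero.\<close>

lemma regular_separation:
  fixes s t :: "'a::comm_complex_banach_algebra \<Rightarrow> complex"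
  assumes ht: "hyper_tauberian TYPE('a)"
    and s: "s \<in> carrier_space" and t: "t \<in> carrier_space" and ne: "s \<noteq> t"
  obtains j b where "j * b = 0" "s j \<noteq> 0" "t b \<noteq> 0"
proof -
  obtain a where a: "s a \<noteq> t a" using ne by blast
  define r where "r = dist (s a) (t a) / 2"
  define F where "F u = {v \<in> carrier_space. r \<le> dist (v a) (u a)}" for u :: "'a \<Rightarrow> complex"
  have cl: "closedin (top_of_set carrier_space) (F u)" for u
  proof -
    have "closed {v :: 'a \<Rightarrow> complex. r \<le> dist (v a) (u a)}"
      by (intro closed_Collect_le continuous_intros) (auto intro: continuous_on_product_coordinates)
    then show ?thesis unfolding F_def by (auto simp: closedin_closed)
  qed
  have "0 < r" using a by (simp add: r_def)
  have reg: "\<exists>b. u b \<noteq> 0 \<and> (\<forall>v\<in>F u. v b = 0)" if "u \<in> carrier_space" for u :: "'a \<Rightarrow> complex"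
  proof -
    have "u \<in> carrier_space - F u" using that \<open>0 < r\<close> by (simp add: F_def)
    then show ?thesis using ht cl[of u] by (auto simp: hyper_tauberian_def regular_algebra_def)
  qed
  obtain j where j: "s j \<noteq> 0" "\<And>v. v \<in> F s \<Longrightarrow> v j = 0" using reg[OF s] by blast
  obtain b where b: "t b \<noteq> 0" "\<And>v. v \<in> F t \<Longrightarrow> v b = 0" using reg[OF t] by blast
  have "j * b = 0"
  proof (rule hyper_tauberian_carrier_space_separates[OF ht])
    fix v :: "'a \<Rightarrow> complex" assume v: "v \<in> carrier_space"
    have "v \<in> F s \<or> v \<in> F t"
      using v dist_triangle2[of "s a" "t a" "v a"] by (auto simp: F_def r_def dist_commute)
    then show "v (j * b) = 0" using j b by (auto simp: carrier_spaceD(2)[OF v])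
  qed
  then show thesis using j b that by blast
qed

section \<open>Spectral synthesis at points, and local units\<close>

text \<open>
  Points are sets of spectral synthesis: a functional \<open>g\<close> that annihilates the elements
  vanishing near \<open>t\<close> has support in \<open>{t}\<close>, hence \<open>a \<mapsto> t(a) g\<close> is local and \<open>g\<close> is
  a multiple of \<open>t\<close>.
\<close>

lemma hyper_tauberian_point_synthesis:
  fixes t :: "'a::comm_complex_banach_algebra \<Rightarrow> complex"
  assumes ht: "hyper_tauberian TYPE('a)" and t: "t \<in> carrier_space" and x: "t x = 0"
    and e: "0 < e"
  obtains j b where "norm (x - j) < e" "j * b = 0" "t b \<noteq> 0"
proof -
  note lin = carrier_spaceD(1)[OF t] and tmult = carrier_spaceD(2)[OF t]
  \<comment> \<open>An algebraic form of vanishing near \<open>t\<close>: if j b = 0, then j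
    vanishes at every character where b does not, and these form an open set around
    \<open>t\<close>.\<close>
  define J where "J = {j. \<exists>b. j * b = 0 \<and> t b \<noteq> 0}"
  have JI: "j \<in> J" if "j * b = 0" "t b \<noteq> 0" for j b using that by (auto simp: J_def)
  have Jmult: "a * j \<in> J" if "j \<in> J" for a j
    using that unfolding J_def by (auto simp: mult.assoc) (metis mult_zero_right)
  have "csubspace J"
    unfolding csubspace_def
  proof (intro conjI ballI allI)
    show "0 \<in> J" using carrier_spaceD(3)[OF t] by (auto simp: J_def)
    fix i j assume "i \<in> J" "j \<in> J"
    then obtain b c where bc: "i * b = 0" "t b \<noteq> 0" "j * c = 0" "t c \<noteq> 0"
      unfolding J_def by blast
    have "(i + j) * (b * c) = (i * b) * c + (j * c) * b" by (simp add: algebra_simps)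
    then show "i + j \<in> J" using bc by (intro JI[of _ "b * c"]) (auto simp: tmult)
  next
    show "c *\<^sub>C j \<in> J" if "j \<in> J" for c j
      using that unfolding J_def by (auto simp: mult_scaleC_left) (metis scaleC_zero_right)
  qed
  have "x \<in> closure J"
  proof (rule ccontr)
    assume "x \<notin> closure J"
    then obtain g where g: "\<And>j. j \<in> J \<Longrightarrow> cdual_apply g j = 0" and gx: "cdual_apply g x \<noteq> 0"
      using Hahn_Banach_separation[OF \<open>csubspace J\<close>] by metis
    have id: "t (a * b) * cdual_apply g c = t b * cdual_apply g (c * a)" for a b c
    proof (rule hyper_tauberian_rank_one[OF ht bounded_clinear_carrier_space[OF t]
          bounded_clinear_cdual_apply])
      fix a assume ta: "t a \<noteq> 0"
      show "ideal_hull {c. \<forall>b. cdual_apply g (b * c) = 0} \<subseteq> supp (*) a"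
      proof
        fix s assume s: "s \<in> ideal_hull {c. \<forall>b. cdual_apply g (b * c) = 0}"
        have sc: "s \<in> carrier_space" and sJ: "\<And>j. j \<in> J \<Longrightarrow> s j = 0"
          using s g Jmult by (auto simp: ideal_hull_def)
        have "s = t"
        proof (rule ccontr)
          assume "s \<noteq> t"
          then obtain j b where "j * b = 0" "s j \<noteq> 0" "t b \<noteq> 0"
            using regular_separation[OF ht sc t] by blast
          then show False using sJ JI by blast
        qed
        moreover have "t \<in> supp (*) a"
        proof -
          have "t c = 0" if "c * a = 0" for c
            using tmult[of c a] that ta by (simp add: clinear_zero[OF lin])
          then show ?thesis using t by (simp add: supp_def ideal_hull_def annihilator_def)
        qed
        ultimately show "s \<in> supp (*) a" by simp
      qed
    qed
    obtain b where b: "t b = 1" using carrier_space_obtain_one[OF t] by blast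
    \<comment> \<open>Both instances of \<open>id\<close> let \<open>b\<close> act as a unit at
      \<open>t\<close>; the second also uses t(x) = 0.\<close>
    have "cdual_apply g x = cdual_apply g (x * b)"
      using id[of b b x] by (simp add: tmult b)
    also have "\<dots> = 0"
      using id[of x b b] by (simp add: tmult b x mult.commute)
    finally show False using gx by simp
  qed
  then obtain j where "j \<in> J" "dist j x < e" using e closure_approachable by blast
  then show thesis using that by (auto simp: J_def dist_norm norm_minus_commute)
qed

text \<open>
  Pick \<open>a\<close> with \<open>t(a) = 1\<close>. By synthesis at \<open>t\<close>, the element \<open>a - a\<^sup>2\<close> becomes small modulo
  the annihilator of some \<open>b\<close> with \<open>t(b) \<noteq> 0\<close>, so \<open>a\<close> is close to an idempotent \<open>e\<close> there;
  then \<open>e b\<close> has the unit \<open>e\<close>. With \<open>e = a + (1 - 2 a) y\<close>, idempotency amounts to the fixed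
  point equation for \<open>y\<close> solved in the proof.
\<close>

lemma hyper_tauberian_local_unit:
  fixes t :: "'a::comm_complex_banach_algebra \<Rightarrow> complex"
  assumes ht: "hyper_tauberian TYPE('a)" and t: "t \<in> carrier_space"
  obtains e b where "e * b = b" "t b \<noteq> 0"
proof -
  note lin = carrier_spaceD(1)[OF t] and tmult = carrier_spaceD(2)[OF t]
  note tlin = clinear_add[OF lin] clinear_diff[OF lin] tmult
  obtain a where a: "t a = 1" using carrier_space_obtain_one[OF t] by blast
  have "t (a - a * a) = 0" by (simp add: tlin a)
  \<comment> \<open>The constant 1/100 leaves room: with 4 z of norm at most 1/25, the map
    \<open>F\<close> below has Lipschitz constant at most 1/2 on the ball of radius 1/10, and 1/2 *
    1/10 + 1/100 is still below 1/10.\<close>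
  then obtain j b where j: "norm (a - a * a - j) < 1/100" and jb: "j * b = 0" and b: "t b \<noteq> 0"
    by (rule hyper_tauberian_point_synthesis[OF ht t, of _ "1/100"]) auto
  define z where "z = a - a * a - j"
  define z4 where "z4 = z + z + z + z"
  \<comment> \<open>For e = a + (1 - 2 a) y, the square of 1 - 2 a is 1 - 4 (a - a a). Replacing a -
    a a by z turns e e - e into (1 - 4 z)(y y - y) - z, which is \<open>F y - y\<close>.\<close>
  define F where "F y = y * y - z4 * (y * y) + z4 * y - z" for y
  have z: "norm z \<le> 1/100" using j by (simp add: z_def)
  have z4: "norm z4 \<le> 1/25"
    unfolding z4_def using z by norm
  have contr: "dist (F y) (F w) \<le> 1/2 * dist y w" if "y \<in> cball 0 (1/10)" "w \<in> cball 0 (1/10)" for y w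
  proof -
    define d where "d = norm (y - w)"
    have sum: "norm (y + w) \<le> 1/5" using that norm_triangle_ineq[of y w] by simp
    have 1: "norm ((y - w) * (y + w)) \<le> d * (1/5)"
      using sum by (intro order_trans[OF norm_mult_ineq] mult_mono) (auto simp: d_def)
    have 2: "norm (z4 * ((y - w) * (y + w))) \<le> 1/25 * (d * (1/5))"
      by (rule order_trans[OF norm_mult_ineq mult_mono[OF z4 1]]) simp_all
    have 3: "norm (z4 * (y - w)) \<le> 1/25 * d"
      using z4 by (intro order_trans[OF norm_mult_ineq] mult_mono) (auto simp: d_def)
    have "F y - F w = (y - w) * (y + w) - z4 * ((y - w) * (y + w)) + z4 * (y - w)"
      by (simp add: F_def algebra_simps)
    also have "norm \<dots> \<le> d * (1/5) + 1/25 * (d * (1/5)) + 1/25 * d"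
      using norm_triangle_ineq[of "(y - w) * (y + w) - z4 * ((y - w) * (y + w))" "z4 * (y - w)"]
        norm_triangle_ineq4[of "(y - w) * (y + w)" "z4 * ((y - w) * (y + w))"] 1 2 3
      by linarith
    also have "\<dots> \<le> 1/2 * d" by (simp add: d_def)
    finally show ?thesis by (simp add: dist_norm d_def)
  qed
  have "F ` cball 0 (1/10) \<subseteq> cball 0 (1/10)"
  proof (rule image_subsetI)
    fix y :: 'a assume y: "y \<in> cball 0 (1/10)"
    have "norm (F y) \<le> dist (F y) (F 0) + norm (F 0)"
      using dist_triangle[of "F y" 0 "F 0"] by simp
    also have "\<dots> \<le> 1/2 * norm y + 1/100"
      using contr[OF y, of 0] z by (simp add: F_def)
    also have "\<dots> \<le> 1/10" using y by simp
    finally show "F y \<in> cball 0 (1/10)" by simp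
  qed
  then have "\<exists>!y. y \<in> cball 0 (1/10) \<and> F y = y"
    using contr by (intro Banach_fix[of _ "1/2"]) (auto simp: closed_cball complete_eq_closed)
  then obtain y where y: "norm y \<le> 1/10" and Fy: "F y = y" by auto
  define e where "e = a + y - (a * y + a * y)"
  define k where "k = j * y + j * y + j * y + j * y"
  \<comment> \<open>The error made by replacing a - a a by z. Each term is a multiple of
    \<open>j\<close>, hence is killed by \<open>b\<close>.\<close>
  have "e * e - e - (F y - y) = - j + k - k * y"
    by (simp add: e_def F_def z4_def z_def k_def algebra_simps)
  then have ee: "e * e - e = - j + k - k * y" by (simp add: Fy)
  have "j * y * b = 0" by (metis jb mult.assoc mult.commute mult_zero_left)
  then have "k * b = 0" by (simp add: k_def distrib_right)
  then have "k * y * b = 0" by (metis mult.assoc mult.commute mult_zero_left)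
  then have "(e * e - e) * b = 0"
    unfolding ee using jb \<open>k * b = 0\<close> by (simp add: distrib_right left_diff_distrib)
  then have idem: "e * (e * b) = e * b" by (simp add: left_diff_distrib mult.assoc)
  \<comment> \<open>It remains to see that \<open>e * b\<close> does not vanish at \<open>t\<close>.
    Since t(z) = 0, the fixed point equation makes t(y) equal to 0 or 1, and contractivity of
    \<open>t\<close> excludes 1; hence t(e) = 1.\<close>
  have "t j * t b = 0" using jb by (metis tmult clinear_zero[OF lin])
  then have tz: "t z = 0" using b by (simp add: z_def tlin a)
  have "t (F y) = t y * t y" by (simp add: F_def z4_def tlin tz)
  then have "t y * t y = t y" by (simp add: Fy)
  moreover have "t y \<noteq> 1"
    using carrier_space_contractive[OF t, of y] y by auto
  ultimately have "t y = 0" by simp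
  then have "t (e * b) \<noteq> 0" using b by (simp add: e_def tlin a)
  then show thesis using idem that by blast
qed

text \<open>If d and e are units for b and c, then d + e - d e is one for b + c, so these elements
  form an ideal. By the existence of local units at each character its hull is empty.\<close>

lemma hyper_tauberian_local_units_dense:
  assumes ht: "hyper_tauberian TYPE('a::comm_complex_banach_algebra)"
  shows "closure {b::'a. \<exists>e. e * b = b} = UNIV"
proof (rule hyper_tauberian_ideal_dense[OF ht])
  show "algebra_ideal {b::'a. \<exists>e. e * b = b}"
    unfolding algebra_ideal_def
  proof (intro conjI ballI allI)
    fix b c :: 'a assume "b \<in> {b. \<exists>e. e * b = b}" "c \<in> {b. \<exists>e. e * b = b}"
    then obtain d e where de: "d * b = b" "e * c = c" by blast
    have "(d + e - d * e) * (b + c) = d * b + e * c + (e * b - e * (d * b)) + (d * c - d * (e * c))"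
      by (simp add: algebra_simps)
    then have "(d + e - d * e) * (b + c) = b + c" by (simp add: de)
    then show "b + c \<in> {b. \<exists>e. e * b = b}" by blast
  next
    fix b c :: 'a assume "b \<in> {b. \<exists>e. e * b = b}"
    then obtain e where e: "e * b = b" by blast
    have "e * (c * b) = c * b" by (metis e mult.left_commute)
    then show "c * b \<in> {b. \<exists>e. e * b = b}" by blast
  qed (auto simp: mult_scaleC_right, metis)
  have "\<exists>b. (\<exists>e. e * b = b) \<and> t b \<noteq> 0" if "t \<in> carrier_space" for t :: "'a \<Rightarrow> complex"
    using hyper_tauberian_local_unit[OF ht that] by blast
  then show "ideal_hull {b::'a. \<exists>e. e * b = b} = {}"
    by (auto simp: ideal_hull_def)
qed

section \<open>The unitization\<close>

text \<open>A type of its own, so that the norm can be the sum of the norms of the parts, which is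
  submultiplicative. A new unit is adjoined even when the algebra already has one.\<close>

datatype 'a unitization = Unitize (algebra_part: 'a) (scalar_part: complex)

lemma unitization_eqI:
  "algebra_part u = algebra_part v \<Longrightarrow> scalar_part u = scalar_part v \<Longrightarrow> u = v"
  by (rule unitization.expand) simp

instantiation unitization :: (complex_normed_vector) complex_normed_vector
begin

definition zero_unitization :: "'a unitization"
  where "0 = Unitize 0 0"

definition plus_unitization :: "'a unitization \<Rightarrow> 'a unitization \<Rightarrow> 'a unitization"
  where "u + v = Unitize (algebra_part u + algebra_part v) (scalar_part u + scalar_part v)"

definition minus_unitization :: "'a unitization \<Rightarrow> 'a unitization \<Rightarrow> 'a unitization"
  where "u - v = Unitize (algebra_part u - algebra_part v) (scalar_part u - scalar_part v)"

definition uminus_unitization :: "'a unitization \<Rightarrow> 'a unitization"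
  where "- u = Unitize (- algebra_part u) (- scalar_part u)"

definition scaleR_unitization :: "real \<Rightarrow> 'a unitization \<Rightarrow> 'a unitization"
  where "r *\<^sub>R u = Unitize (r *\<^sub>R algebra_part u) (r *\<^sub>R scalar_part u)"

definition scaleC_unitization :: "complex \<Rightarrow> 'a unitization \<Rightarrow> 'a unitization"
  where "c *\<^sub>C u = Unitize (c *\<^sub>C algebra_part u) (c * scalar_part u)"

definition norm_unitization :: "'a unitization \<Rightarrow> real"
  where "norm u = norm (algebra_part u) + cmod (scalar_part u)"

definition dist_unitization :: "'a unitization \<Rightarrow> 'a unitization \<Rightarrow> real"
  where "dist u v = norm (u - v)" for u v :: "'a unitization"

definition sgn_unitization :: "'a unitization \<Rightarrow> 'a unitization"
  where "sgn u = inverse (norm u) *\<^sub>R u" for u :: "'a unitization"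

definition uniformity_unitization :: "('a unitization \<times> 'a unitization) filter"
  where "uniformity_unitization = (INF e\<in>{0 <..}. principal {(u, v). dist u v < e})"

definition open_unitization :: "'a unitization set \<Rightarrow> bool"
  where "open_unitization S \<longleftrightarrow> (\<forall>u\<in>S. \<forall>\<^sub>F (u', v) in uniformity. u' = u \<longrightarrow> v \<in> S)"

lemmas unitization_defs = zero_unitization_def plus_unitization_def minus_unitization_def
  uminus_unitization_def scaleR_unitization_def scaleC_unitization_def

instance
proof
  fix u v w :: "'a unitization" and c d :: complex and r s :: real
  show "norm u = 0 \<longleftrightarrow> u = 0"
    by (cases u) (simp add: norm_unitization_def unitization_defs add_nonneg_eq_0_iff)
  show "norm (u + v) \<le> norm u + norm v"
    using norm_triangle_ineq[of "algebra_part u" "algebra_part v"]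
      norm_triangle_ineq[of "scalar_part u" "scalar_part v"]
    by (simp add: norm_unitization_def unitization_defs)
qed (simp_all add: dist_unitization_def sgn_unitization_def uniformity_unitization_def
    open_unitization_def norm_unitization_def unitization_defs algebra_simps scaleC_add_left
    scaleC_add_right scaleC_scaleC scaleC_of_real norm_scaleC norm_mult scaleR_conv_of_real)

end

lemma norm_algebra_part_le: "norm (algebra_part u) \<le> norm u"
  and norm_scalar_part_le: "norm (scalar_part u) \<le> norm u"
  by (auto simp: norm_unitization_def)

instance unitization :: (complex_banach) complex_banach
proof
  fix X :: "nat \<Rightarrow> 'a unitization"
  assume X: "Cauchy X"
  have "Cauchy (\<lambda>n. algebra_part (X n))"
    using X norm_algebra_part_le[of "X _ - X _"] unfolding Cauchy_def dist_norm
    by (simp add: minus_unitization_def) (meson le_less_trans)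
  moreover have "Cauchy (\<lambda>n. scalar_part (X n))"
    using X norm_scalar_part_le[of "X _ - X _"] unfolding Cauchy_def dist_norm
    by (simp add: minus_unitization_def) (meson le_less_trans)
  ultimately obtain a c where "(\<lambda>n. algebra_part (X n)) \<longlonglongrightarrow> a" "(\<lambda>n. scalar_part (X n)) \<longlonglongrightarrow> c"
    using Cauchy_convergent_iff convergent_def by metis
  then have "(\<lambda>n. norm (algebra_part (X n) - a) + norm (scalar_part (X n) - c)) \<longlonglongrightarrow> 0 + 0"
    by (intro tendsto_add) (simp_all add: tendsto_norm_zero_iff LIM_zero_iff)
  then have "X \<longlonglongrightarrow> Unitize a c"
    by (subst tendsto_dist_iff) (simp add: dist_norm norm_unitization_def minus_unitization_def)
  then show "convergent X" by (auto simp: convergent_def)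
qed

instantiation unitization :: (comm_complex_banach_algebra) comm_complex_banach_algebra
begin

definition times_unitization :: "'a unitization \<Rightarrow> 'a unitization \<Rightarrow> 'a unitization"
  where "u * v = Unitize
    (algebra_part u * algebra_part v + scalar_part u *\<^sub>C algebra_part v
      + scalar_part v *\<^sub>C algebra_part u)
    (scalar_part u * scalar_part v)"

instance
proof
  fix u v w :: "'a unitization" and c :: complex and r :: real
  show "norm (u * v) \<le> norm u * norm v"
  proof -
    let ?a = "algebra_part u" and ?b = "algebra_part v" and ?c = "scalar_part u" and ?d = "scalar_part v"
    have "norm (?a * ?b + ?c *\<^sub>C ?b + ?d *\<^sub>C ?a) \<le> norm ?a * norm ?b + cmod ?c * norm ?b + cmod ?d * norm ?a"
      by (intro norm_triangle_le add_mono norm_mult_ineq) (simp_all add: norm_scaleC)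
    then show ?thesis
      by (simp add: norm_unitization_def times_unitization_def norm_mult algebra_simps)
  qed
  show "(r *\<^sub>R u) * v = r *\<^sub>R (u * v)" "u * (r *\<^sub>R v) = r *\<^sub>R (u * v)"
    by (simp_all add: times_unitization_def unitization_defs scaleC_of_real[symmetric]
        scaleC_add_right scaleC_scaleC mult_scaleC_left mult_scaleC_right mult_ac scaleR_conv_of_real)
qed (simp_all add: times_unitization_def unitization_defs algebra_simps scaleC_add_left
    scaleC_add_right scaleC_scaleC mult_scaleC_left mult_scaleC_right)

end

instantiation unitization :: (comm_complex_banach_algebra) comm_ring_1
begin

definition one_unitization :: "'a unitization"
  where "1 = Unitize 0 1"

instance
  by standard
    (simp_all add: one_unitization_def times_unitization_def zero_unitization_def unitization_eqI)

end

lemma Unitize_decompose: "Unitize a c = Unitize a 0 + c *\<^sub>C (1 :: 'a::comm_complex_banach_algebra unitization)"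
  by (simp add: one_unitization_def unitization_defs)

lemma Unitize_mult: "Unitize a 0 * Unitize b 0 = Unitize (a * b) 0"
  by (simp add: times_unitization_def)

lemma bounded_clinear_Unitize: "bounded_clinear (\<lambda>a. Unitize a 0)"
  unfolding bounded_clinear_def clinear_def
  by (auto simp: unitization_defs norm_unitization_def intro: exI[of _ 1])

text \<open>The one property of the unitization through which the hyper-Tauberian hypothesis enters
  the cocycle argument.\<close>

definition zero_product_balanced ::
  "'u::{comm_complex_banach_algebra, comm_ring_1} itself \<Rightarrow> 'x::complex_normed_vector itself \<Rightarrow> bool"
  where "zero_product_balanced TYPE('u) TYPE('x) \<longleftrightarrow>
    (\<forall>\<phi> :: 'u \<Rightarrow> 'u \<Rightarrow> 'x.
      bounded_cbilinear \<phi> \<and> (\<forall>u v. u * v = 0 \<longrightarrow> \<phi> u v = 0) \<longrightarrow> (\<forall>u. \<phi> u 1 = \<phi> 1 u))"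

text \<open>
  If \<open>e b = b\<close>, then \<open>\<phi>(b, 1) = \<phi>(b, e) = \<phi>(b e, e) = \<phi>(e, e b) = \<phi>(e, b) = \<phi>(1, b)\<close>; the outer
  equalities hold because \<open>b (1 - e) = 0\<close>.
\<close>

theorem zero_product_balanced_unitization:
  assumes ht: "hyper_tauberian TYPE('a::comm_complex_banach_algebra)"
  shows "zero_product_balanced TYPE('a unitization) TYPE('x::complex_normed_vector)"
  unfolding zero_product_balanced_def
proof (intro allI impI, elim conjE)
  fix \<phi> :: "'a unitization \<Rightarrow> 'a unitization \<Rightarrow> 'x" and u
  assume \<phi>: "bounded_cbilinear \<phi>" and "\<forall>u v. u * v = 0 \<longrightarrow> \<phi> u v = 0"
  then have zero: "\<phi> u v = 0" if "u * v = 0" for u v using that by blast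
  let ?i = "\<lambda>a::'a. Unitize a 0"
  note lin = bounded_cbilinearD[OF \<phi>]
  have bil: "bounded_cbilinear (\<lambda>a b. \<phi> (?i a) (?i b))"
    by (rule bounded_cbilinear_compose[OF bounded_clinear_ident \<phi> bounded_clinear_Unitize
          bounded_clinear_Unitize])
  have bal: "\<phi> (?i (a * b)) (?i c) = \<phi> (?i b) (?i (c * a))" for a b c
    by (rule hyper_tauberian_zero_product[OF ht bil])
      (simp add: zero Unitize_mult zero_unitization_def)
  have unit: "\<phi> (?i b) 1 = \<phi> 1 (?i b)" if e: "e * b = b" for e b
  proof -
    have 0: "(1 - ?i e) * ?i b = 0"
      by (simp add: left_diff_distrib Unitize_mult e)
    have "\<phi> (?i b) (1 - ?i e) = 0" "\<phi> (1 - ?i e) (?i b) = 0"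
      using 0 by (auto intro!: zero simp: mult.commute)
    then have "\<phi> (?i b) 1 = \<phi> (?i b) (?i e)" "\<phi> 1 (?i b) = \<phi> (?i e) (?i b)"
      by (simp_all add: clinear_diff[OF lin(1)] clinear_diff[OF lin(2)])
    moreover have "\<phi> (?i b) (?i e) = \<phi> (?i e) (?i b)"
      using bal[of b e e] by (simp add: e mult.commute[of b e])
    ultimately show ?thesis by simp
  qed
  \<comment> \<open>Both sides are continuous in \<open>b\<close>, so equality spreads from the
    dense ideal; on multiples of 1 it holds by linearity.\<close>
  have "continuous_on UNIV (\<lambda>b. \<phi> (?i b) 1)" "continuous_on UNIV (\<lambda>b. \<phi> 1 (?i b))"
    by (intro linear_continuous_on bounded_clinear_imp_bounded_linear
        bounded_clinear_compose[OF bounded_clinear_fix_right[OF \<phi>] bounded_clinear_Unitize]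
        bounded_clinear_compose[OF bounded_clinear_fix_left[OF \<phi>] bounded_clinear_Unitize])+
  then have "closed {b. \<phi> (?i b) 1 = \<phi> 1 (?i b)}"
    by (rule closed_Collect_eq)
  then have "closure {b. \<exists>e. e * b = b} \<subseteq> {b. \<phi> (?i b) 1 = \<phi> 1 (?i b)}"
    using unit by (intro closure_minimal) auto
  then have *: "\<phi> (?i b) 1 = \<phi> 1 (?i b)" for b
    using hyper_tauberian_local_units_dense[OF ht] by blast
  obtain a :: 'a and c where "u = Unitize a c" by (cases u)
  then have u: "u = ?i a + c *\<^sub>C 1" using Unitize_decompose by simp
  show "\<phi> u 1 = \<phi> 1 u"
    using *[of a] unfolding u
    by (simp add: clinear_add[OF lin(1)] clinear_add[OF lin(2)]
        clinear_scaleC[OF lin(1)] clinear_scaleC[OF lin(2)])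
qed

section \<open>Multilinear maps on lists\<close>

text \<open>Linearity in a slot in append form rather than list update form, because merging two
  neighbours computes on such lists.\<close>

lemma multilinearD:
  assumes "multilinear n T" "length us + length vs + 1 = n"
  shows "clinear (\<lambda>x. T (us @ x # vs))"
proof -
  have "clinear (\<lambda>x. T ((us @ 0 # vs)[length us := x]))"
    using assms unfolding multilinear_def by (metis add_Suc_right length_append length_Cons
        less_add_Suc1 add.assoc Suc_eq_plus1)
  then show ?thesis by simp
qed

lemma multilinearI:
  assumes "\<And>us vs. length us + length vs + 1 = n \<Longrightarrow> clinear (\<lambda>x. T (us @ x # vs))"
  shows "multilinear n T"
  unfolding multilinear_def
proof (intro allI impI)
  fix as :: "'a list" and i assume i: "length as = n \<and> i < n"
  then have "clinear (\<lambda>x. T (take i as @ x # drop (Suc i) as))" by (intro assms) auto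
  moreover have "as[i := x] = take i as @ x # drop (Suc i) as" for x
    using i by (simp add: upd_conv_take_nth_drop)
  ultimately show "clinear (\<lambda>a. T (as[i := a]))" by simp
qed

lemma multilinear_zero:
  assumes "multilinear n T" "length as = n" "0 \<in> set as"
  shows "T as = 0"
proof -
  obtain us vs where "as = us @ 0 # vs" using assms(3) by (meson split_list)
  then show ?thesis using clinear_zero[OF multilinearD[OF assms(1)], of us vs] assms(2) by simp
qed

lemma clinear_compose: "clinear f \<Longrightarrow> clinear g \<Longrightarrow> clinear (\<lambda>x. f (g x))"
  by (simp add: clinear_def)

lemma clinear_plus: "clinear f \<Longrightarrow> clinear g \<Longrightarrow> clinear (\<lambda>x. f x + g x)"
  by (simp add: clinear_def scaleC_add_right algebra_simps)

lemma scaleC_scaleR_commute: "c *\<^sub>C (r *\<^sub>R x) = r *\<^sub>R (c *\<^sub>C x)"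
  by (simp add: scaleC_of_real[symmetric] scaleC_scaleC mult.commute)

lemma clinear_scaleR_right: "clinear f \<Longrightarrow> clinear (\<lambda>x. r *\<^sub>R f x)"
  by (simp add: clinear_def scaleC_scaleR_commute algebra_simps)

lemma multilinear_plus: "multilinear n F \<Longrightarrow> multilinear n G \<Longrightarrow> multilinear n (\<lambda>as. F as + G as)"
  by (rule multilinearI) (rule clinear_plus; erule (1) multilinearD)

lemma multilinear_scaleR: "multilinear n F \<Longrightarrow> multilinear n (\<lambda>as. r *\<^sub>R F as)"
  by (rule multilinearI) (rule clinear_scaleR_right, erule (1) multilinearD)

lemma bounded_multilinear_bound:
  assumes "bounded_multilinear n T"
  shows "\<exists>K\<ge>0. \<forall>as. length as = n \<longrightarrow> norm (T as) \<le> K * (\<Prod>a\<leftarrow>as. norm a)"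
proof -
  obtain K where K: "\<And>as. length as = n \<Longrightarrow> norm (T as) \<le> K * (\<Prod>a\<leftarrow>as. norm a)"
    using assms by (auto simp: bounded_multilinear_def)
  have nonneg: "0 \<le> (\<Prod>a\<leftarrow>as. norm a)" for as :: "'a list"
    by (induction as) auto
  have "norm (T as) \<le> max K 0 * (\<Prod>a\<leftarrow>as. norm a)" if "length as = n" for as
    using K[OF that] mult_right_mono[OF max.cobounded1 nonneg, of K as 0] by linarith
  then show ?thesis by (intro exI[of _ "max K 0"]) simp
qed

lemma bounded_multilinear_plus:
  assumes F: "bounded_multilinear n F" and G: "bounded_multilinear n G"
  shows "bounded_multilinear n (\<lambda>as. F as + G as)"
proof -
  obtain K L where
    "\<And>as. length as = n \<Longrightarrow> norm (F as) \<le> K * (\<Prod>a\<leftarrow>as. norm a)"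
    "\<And>as. length as = n \<Longrightarrow> norm (G as) \<le> L * (\<Prod>a\<leftarrow>as. norm a)"
    using F G by (auto simp: bounded_multilinear_def)
  then have "norm (F as + G as) \<le> (K + L) * (\<Prod>a\<leftarrow>as. norm a)" if "length as = n" for as
    using that by (simp add: distrib_right norm_triangle_mono)
  then show ?thesis
    using F G unfolding bounded_multilinear_def by (blast intro: multilinear_plus)
qed

lemma bounded_multilinear_scaleR:
  assumes F: "bounded_multilinear n F" shows "bounded_multilinear n (\<lambda>as. r *\<^sub>R F as)"
proof -
  obtain K where "\<And>as. length as = n \<Longrightarrow> norm (F as) \<le> K * (\<Prod>a\<leftarrow>as. norm a)"
    using F by (auto simp: bounded_multilinear_def)
  then have "norm (r *\<^sub>R F as) \<le> (\<bar>r\<bar> * K) * (\<Prod>a\<leftarrow>as. norm a)" if "length as = n" for as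
    using that by (simp add: mult.assoc mult_left_mono)
  then show ?thesis
    using F unfolding bounded_multilinear_def by (blast intro: multilinear_scaleR)
qed

lemma bounded_multilinear_slot:
  assumes F: "bounded_multilinear n F" and len: "length us + length vs + 1 = n"
  shows "bounded_clinear (\<lambda>x. F (us @ x # vs))"
proof -
  obtain K where K: "\<And>as. length as = n \<Longrightarrow> norm (F as) \<le> K * (\<Prod>a\<leftarrow>as. norm a)"
    using F by (auto simp: bounded_multilinear_def)
  have "norm (F (us @ x # vs)) \<le> (K * ((\<Prod>a\<leftarrow>us. norm a) * (\<Prod>a\<leftarrow>vs. norm a))) * norm x" for x
    using K[of "us @ x # vs"] len by (simp add: mult_ac)
  then show ?thesis
    using F len unfolding bounded_multilinear_def bounded_clinear_def
    by (intro conjI exI allI) (auto intro: multilinearD)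
qed

text \<open>Produces the bilinear maps in two adjacent slots to which balancedness is
  applied.\<close>

lemma bounded_multilinear_two_slots:
  assumes F: "bounded_multilinear n F" and len: "length us + length vs + 2 = n"
  shows "bounded_cbilinear (\<lambda>x y. F (us @ x # y # vs))"
proof -
  obtain K where K: "\<And>as. length as = n \<Longrightarrow> norm (F as) \<le> K * (\<Prod>a\<leftarrow>as. norm a)"
    using F by (auto simp: bounded_multilinear_def)
  have lin: "multilinear n F" using F by (simp add: bounded_multilinear_def)
  have "norm (F (us @ x # y # vs)) \<le> (K * ((\<Prod>a\<leftarrow>us. norm a) * (\<Prod>a\<leftarrow>vs. norm a))) * norm x * norm y"
    for x y
    using K[of "us @ x # y # vs"] len by (simp add: mult_ac)
  moreover have "clinear (\<lambda>x. F (us @ x # y # vs))" for y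
    using len by (intro multilinearD[OF lin]) simp
  moreover have "clinear (\<lambda>y. F (us @ x # y # vs))" for x
    using multilinearD[OF lin, of "us @ [x]" vs] len by simp
  ultimately show ?thesis
    unfolding bounded_cbilinear_def by (intro conjI exI allI)
qed

section \<open>Coboundaries\<close>

text \<open>The inner face maps of the Hochschild complex, with \<open>j\<close> counted from 1 as
  in the coboundary, while list positions count from 0.\<close>

definition merge_at :: "nat \<Rightarrow> 'a::times list \<Rightarrow> 'a list"
  where "merge_at j as = take (j - 1) as @ [as ! (j - 1) * as ! j] @ drop (j + 1) as"

lemma length_merge_at: "1 \<le> j \<Longrightarrow> j < length as \<Longrightarrow> length (merge_at j as) = length as - 1"
  by (simp add: merge_at_def)

lemma merge_at_append: "merge_at (Suc (length us)) (us @ x # y # vs) = us @ (x * y) # vs"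
  by (simp add: merge_at_def nth_append)

text \<open>The coboundary cut off after its summand \<open>k\<close>, so without the right action.
  It is the quantity carried through the induction, in which \<open>k\<close> counts the product
  conditions already removed.\<close>

definition partial_coboundary ::
  "('a::complex_banach_algebra \<Rightarrow> 'x::complex_banach \<Rightarrow> 'x) \<Rightarrow> nat \<Rightarrow> ('a list \<Rightarrow> 'x) \<Rightarrow> 'a list \<Rightarrow> 'x"
  where "partial_coboundary lact k T as =
    lact (as ! 0) (T (drop 1 as)) + (\<Sum>j = 1..k. (-1) ^ j *\<^sub>R T (merge_at j as))"

lemma coboundary_eq_partial:
  "coboundary lact ract n T as =
    partial_coboundary lact n T as + (-1) ^ (n + 1) *\<^sub>R ract (T (take n as)) (as ! n)"
  by (simp add: coboundary_def partial_coboundary_def merge_at_def)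

lemma partial_coboundary_0: "partial_coboundary lact 0 T (x # as) = lact x (T as)"
  by (simp add: partial_coboundary_def)

lemma partial_coboundary_Suc:
  "partial_coboundary lact (Suc k) T as =
    partial_coboundary lact k T as + (-1) ^ Suc k *\<^sub>R T (merge_at (Suc k) as)"
  by (simp add: partial_coboundary_def)

lemma multilinear_merge_at:
  fixes T :: "'a::complex_banach_algebra list \<Rightarrow> 'x::complex_normed_vector"
  assumes T: "multilinear n T" and j: "1 \<le> j" "j \<le> n"
  shows "multilinear (n + 1) (\<lambda>as. T (merge_at j as))"
proof (rule multilinearI)
  fix us vs :: "'a list" assume len: "length us + length vs + 1 = n + 1"
  \<comment> \<open>The varying entry stands before the merged pair, is its left factor, is its
    right factor, or stands after it.\<close>
  consider "length us + 1 < j" | "length us + 1 = j" | "length us = j" | "j < length us" by linarith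
  then show "clinear (\<lambda>x. T (merge_at j (us @ x # vs)))"
  proof cases
    case 1
    then have "merge_at j (us @ x # vs) = us @ x # merge_at (j - (length us + 1)) vs" for x
      by (auto simp: merge_at_def nth_append nth_Cons' take_Cons' drop_Cons' Suc_diff_Suc)
    moreover have "length us + length (merge_at (j - (length us + 1)) vs) + 1 = n"
      using 1 len j by (subst length_merge_at) auto
    ultimately show ?thesis using multilinearD[OF T] by simp
  next
    case 2
    then obtain y ws where vs: "vs = y # ws" using j len by (cases vs) auto
    have eq: "merge_at j (us @ x # vs) = us @ (x * y) # ws" for x
      using 2 merge_at_append[of us x y ws] by (simp add: vs)
    have "clinear (\<lambda>x. T (us @ x # ws))" using multilinearD[OF T, of us ws] len vs by simp
    then have "clinear (\<lambda>x. T (us @ (x * y) # ws))"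
      by (rule clinear_compose) (use bounded_clinear_mult_left in \<open>auto simp: bounded_clinear_def\<close>)
    then show ?thesis by (simp add: eq)
  next
    case 3
    then obtain ws y where us: "us = ws @ [y]" using j by (cases us rule: rev_cases) auto
    have eq: "merge_at j (us @ x # vs) = ws @ (y * x) # vs" for x
      using 3 merge_at_append[of ws y x vs] by (simp add: us)
    have "clinear (\<lambda>x. T (ws @ x # vs))" using multilinearD[OF T, of ws vs] len us by simp
    then have "clinear (\<lambda>x. T (ws @ (y * x) # vs))"
      by (rule clinear_compose) (use bounded_clinear_mult_right in \<open>auto simp: bounded_clinear_def\<close>)
    then show ?thesis by (simp add: eq)
  next
    case 4
    then have "merge_at j (us @ x # vs) = merge_at j us @ x # vs" for x
      using j by (auto simp: merge_at_def nth_append)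
    moreover have "length (merge_at j us) + length vs + 1 = n"
      using 4 len j by (subst length_merge_at) auto
    ultimately show ?thesis using multilinearD[OF T] by simp
  qed
qed

lemma bounded_multilinear_merge_at:
  fixes T :: "'a::complex_banach_algebra list \<Rightarrow> 'x::complex_normed_vector"
  assumes T: "bounded_multilinear n T" and j: "1 \<le> j" "j \<le> n"
  shows "bounded_multilinear (n + 1) (\<lambda>as. T (merge_at j as))"
proof -
  have lin: "multilinear n T" using T by (simp add: bounded_multilinear_def)
  obtain K where K0: "0 \<le> K"
    and K: "\<And>as. length as = n \<Longrightarrow> norm (T as) \<le> K * (\<Prod>a\<leftarrow>as. norm a)"
    using bounded_multilinear_bound[OF T] by blast
  have nonneg: "0 \<le> (\<Prod>a\<leftarrow>as. norm a)" for as :: "'a list"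
    by (induction as) auto
  have "norm (T (merge_at j as)) \<le> K * (\<Prod>a\<leftarrow>as. norm a)" if len: "length as = n + 1" for as
  proof -
    define us where "us = take (j - 1) as"
    define vs where "vs = drop (j + 1) as"
    define x where "x = as ! (j - 1)"
    define y where "y = as ! j"
    have "drop (j - 1) as = x # y # vs"
      using j len Cons_nth_drop_Suc[of "j - 1" as] Cons_nth_drop_Suc[of j as]
      by (simp add: x_def y_def vs_def)
    then have as: "as = us @ x # y # vs"
      by (metis append_take_drop_id us_def)
    have m: "merge_at j as = us @ (x * y) # vs"
      by (simp add: merge_at_def us_def vs_def x_def y_def)
    have "norm (T (merge_at j as)) \<le> K * (\<Prod>a\<leftarrow>merge_at j as. norm a)"
      using len j by (intro K) (simp add: length_merge_at)
    also have "(\<Prod>a\<leftarrow>merge_at j as. norm a) = norm (x * y) * ((\<Prod>a\<leftarrow>us. norm a) * (\<Prod>a\<leftarrow>vs. norm a))"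
      by (simp add: m)
    also have "\<dots> \<le> (norm x * norm y) * ((\<Prod>a\<leftarrow>us. norm a) * (\<Prod>a\<leftarrow>vs. norm a))"
      by (intro mult_right_mono norm_mult_ineq mult_nonneg_nonneg nonneg)
    also have "\<dots> = (\<Prod>a\<leftarrow>as. norm a)" by (simp add: as)
    finally show ?thesis using K0 by (simp add: mult_left_mono)
  qed
  then show ?thesis
    using multilinear_merge_at[OF lin j] unfolding bounded_multilinear_def by blast
qed

lemma multilinear_left_action:
  fixes lact :: "'a::complex_normed_vector \<Rightarrow> 'y::complex_normed_vector \<Rightarrow> 'x::complex_normed_vector"
  assumes L: "bounded_cbilinear lact" and T: "multilinear n T"
  shows "multilinear (n + 1) (\<lambda>as. lact (as ! 0) (T (drop 1 as)))"
proof (rule multilinearI)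
  fix us vs :: "'a list" assume len: "length us + length vs + 1 = n + 1"
  show "clinear (\<lambda>x. lact ((us @ x # vs) ! 0) (T (drop 1 (us @ x # vs))))"
  proof (cases us)
    case Nil
    then show ?thesis using bounded_cbilinearD(1)[OF L] by simp
  next
    case (Cons u us')
    then show ?thesis
      using clinear_compose[OF bounded_cbilinearD(2)[OF L] multilinearD[OF T, of us' vs]] len by simp
  qed
qed

lemma multilinear_right_action:
  fixes ract :: "'y::complex_normed_vector \<Rightarrow> 'a::complex_normed_vector \<Rightarrow> 'x::complex_normed_vector"
  assumes R: "bounded_cbilinear ract" and T: "multilinear n T"
  shows "multilinear (n + 1) (\<lambda>as. ract (T (take n as)) (as ! n))"
proof (rule multilinearI)
  fix us vs :: "'a list" assume len: "length us + length vs + 1 = n + 1"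
  show "clinear (\<lambda>x. ract (T (take n (us @ x # vs))) ((us @ x # vs) ! n))"
  proof (cases vs rule: rev_cases)
    case Nil
    then show ?thesis using bounded_cbilinearD(2)[OF R] len by (simp add: nth_append)
  next
    case (snoc vs' v)
    have "take n (us @ x # vs) = us @ x # vs'" "(us @ x # vs) ! n = v" for x
      using snoc len by (auto simp: nth_append take_Cons')
    then show ?thesis
      using clinear_compose[OF bounded_cbilinearD(1)[OF R] multilinearD[OF T, of us vs']] len snoc
      by simp
  qed
qed

lemma bounded_multilinear_left_action:
  assumes L: "bounded_cbilinear lact" and T: "bounded_multilinear n T"
  shows "bounded_multilinear (n + 1) (\<lambda>as. lact (as ! 0) (T (drop 1 as)))"
proof -
  obtain K where K0: "0 \<le> K" and K: "\<And>a x. norm (lact a x) \<le> K * norm a * norm x"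
    using bounded_cbilinear_bound[OF L] by blast
  obtain M where M: "\<And>as. length as = n \<Longrightarrow> norm (T as) \<le> M * (\<Prod>a\<leftarrow>as. norm a)"
    using bounded_multilinear_bound[OF T] by blast
  have "norm (lact (as ! 0) (T (drop 1 as))) \<le> (K * M) * (\<Prod>a\<leftarrow>as. norm a)"
    if len: "length as = n + 1" for as
  proof -
    obtain a bs where as: "as = a # bs" using len by (cases as) auto
    have "norm (lact a (T bs)) \<le> (K * norm a) * (M * (\<Prod>a\<leftarrow>bs. norm a))"
      using K[of a "T bs"] mult_left_mono[OF M[of bs], of "K * norm a"] len as K0
      by (simp add: order_trans)
    then show ?thesis by (simp add: as mult_ac)
  qed
  moreover have "multilinear n T" using T by (simp add: bounded_multilinear_def)
  ultimately show ?thesis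
    using multilinear_left_action[OF L] unfolding bounded_multilinear_def by blast
qed

lemma multilinear_partial_coboundary:
  assumes "bounded_cbilinear lact" "multilinear n T" "k \<le> n"
  shows "multilinear (n + 1) (partial_coboundary lact k T)"
  using assms(3)
proof (induction k)
  case 0
  show ?case
    using multilinear_left_action[OF assms(1,2)] by (simp add: partial_coboundary_def[abs_def])
next
  case (Suc k)
  then show ?case
    unfolding partial_coboundary_Suc[abs_def]
    by (intro multilinear_plus multilinear_scaleR multilinear_merge_at[OF assms(2)]) auto
qed

lemma bounded_multilinear_partial_coboundary:
  assumes "bounded_cbilinear lact" "bounded_multilinear n T" "k \<le> n"
  shows "bounded_multilinear (n + 1) (partial_coboundary lact k T)"
  using assms(3)
proof (induction k)
  case 0
  show ?case
    using bounded_multilinear_left_action[OF assms(1,2)] by (simp add: partial_coboundary_def[abs_def])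
next
  case (Suc k)
  then show ?case
    unfolding partial_coboundary_Suc[abs_def]
    by (intro bounded_multilinear_plus bounded_multilinear_scaleR
        bounded_multilinear_merge_at[OF assms(2)]) auto
qed

lemma multilinear_coboundary:
  assumes "bounded_cbilinear lact" "bounded_cbilinear ract" "multilinear n T"
  shows "multilinear (n + 1) (coboundary lact ract n T)"
  unfolding coboundary_eq_partial[abs_def]
  by (intro multilinear_plus multilinear_scaleR multilinear_partial_coboundary
      multilinear_right_action assms order_refl)

section \<open>Normalized cochains over a unital algebra\<close>

definition normalized :: "nat \<Rightarrow> ('a::one list \<Rightarrow> 'x::zero) \<Rightarrow> bool"
  where "normalized n T \<longleftrightarrow> (\<forall>as. length as = n \<and> 1 \<in> set as \<longrightarrow> T as = 0)"

locale unital_bimodule =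
  fixes lact :: "'u::{comm_complex_banach_algebra, comm_ring_1} \<Rightarrow> 'x::complex_banach \<Rightarrow> 'x"
    and ract :: "'x \<Rightarrow> 'u \<Rightarrow> 'x"
  assumes bimodule: "banach_bimodule lact ract"
    and lact_one: "lact 1 x = x" and ract_one: "ract x 1 = x"
begin

lemma lact_bilinear: "bounded_cbilinear lact" and ract_bilinear: "bounded_cbilinear ract"
  using bimodule by (auto simp: banach_bimodule_def banach_left_module_def banach_right_module_def)

lemma ract_mult: "ract (ract x a) b = ract x (a * b)"
  using bimodule by (simp add: banach_bimodule_def banach_right_module_def)

lemmas lact_linear = bounded_cbilinearD[OF lact_bilinear]
lemmas ract_linear = bounded_cbilinearD[OF ract_bilinear]

text \<open>All merges happen to the left of the 1, so it survives as an argument of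
  \<open>T\<close> in every summand.\<close>

lemma partial_coboundary_one_after:
  assumes T: "normalized n T" and "length us + length vs = n" "k < length us"
  shows "partial_coboundary lact k T (us @ 1 # vs) = 0"
  using assms(3)
proof (induction k)
  case 0
  then obtain u us' where us: "us = u # us'" by (cases us) auto
  then have "T (us' @ 1 # vs) = 0" using T assms(2) by (simp add: normalized_def)
  then show ?case by (simp add: us partial_coboundary_0 clinear_zero[OF lact_linear(2)])
next
  case (Suc k)
  have "length (merge_at (Suc k) (us @ 1 # vs)) = n"
    using Suc.prems assms(2) by (subst length_merge_at) auto
  moreover have "1 \<in> set (merge_at (Suc k) (us @ 1 # vs))"
    using Suc.prems by (simp add: merge_at_def)
  ultimately have "T (merge_at (Suc k) (us @ 1 # vs)) = 0" using T by (simp add: normalized_def)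
  then show ?case using Suc by (simp add: partial_coboundary_Suc)
qed

text \<open>Only the last merge absorbs the 1, or the left action if \<open>us\<close> is empty;
  every earlier summand still contains it.\<close>

lemma partial_coboundary_one_at:
  assumes T: "normalized n T" and len: "length us + length vs = n"
  shows "partial_coboundary lact (length us) T (us @ 1 # vs) = (-1) ^ length us *\<^sub>R T (us @ vs)"
proof (cases us rule: rev_cases)
  case Nil
  then show ?thesis by (simp add: partial_coboundary_0 lact_one)
next
  case (snoc ws w)
  have "partial_coboundary lact (length ws) T (us @ 1 # vs) = 0"
    using snoc by (intro partial_coboundary_one_after[OF T len]) simp
  then show ?thesis
    using merge_at_append[of ws w 1 vs] by (simp add: snoc partial_coboundary_Suc)
qed

text \<open>The 1 is absorbed twice, from the left neighbour (or the left action) and from the right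
  one, with opposite signs; the other summands keep it and vanish.\<close>

lemma partial_coboundary_one_before:
  assumes T: "normalized n T" and len: "length us + length vs = n"
    and k: "length us < k" "k \<le> n"
  shows "partial_coboundary lact k T (us @ 1 # vs) = 0"
  using k
proof (induction k)
  case (Suc k)
  show ?case
  proof (cases "k = length us")
    case True
    then obtain v vs' where vs: "vs = v # vs'" using len Suc.prems by (cases vs) auto
    show ?thesis
      using partial_coboundary_one_at[OF T len] merge_at_append[of us 1 v vs'] True
      by (simp add: partial_coboundary_Suc vs)
  next
    case False
    have "length (merge_at (Suc k) (us @ 1 # vs)) = n"
      using Suc.prems len by (subst length_merge_at) auto
    moreover have "1 \<in> set (merge_at (Suc k) (us @ 1 # vs))"
      using Suc.prems False by (auto simp: merge_at_def take_Cons')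
    ultimately have "T (merge_at (Suc k) (us @ 1 # vs)) = 0" using T by (simp add: normalized_def)
    then show ?thesis using Suc False by (simp add: partial_coboundary_Suc)
  qed
qed simp

text \<open>A final 1 is absorbed by the right action, which cancels the term left by the partial
  coboundary; any other 1 survives in the right action term. Thus the cocycle identity over the
  unitization has to be checked only on the original algebra.\<close>

lemma coboundary_one:
  assumes T: "normalized n T" and len: "length as = n + 1" and one: "1 \<in> set as"
  shows "coboundary lact ract n T as = 0"
proof -
  obtain us vs where as: "as = us @ 1 # vs" using one by (meson split_list)
  have len': "length us + length vs = n" using len as by simp
  show ?thesis
  proof (cases vs rule: rev_cases)
    case Nil
    then show ?thesis
      using partial_coboundary_one_at[OF T len'] len'
      by (simp add: coboundary_eq_partial as ract_one nth_append)
  next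
    case (snoc vs' v)
    have "take n as = us @ 1 # vs'" using snoc len' by (simp add: as take_Cons')
    then have "T (take n as) = 0" using T snoc len' by (simp add: normalized_def)
    moreover have "partial_coboundary lact n T as = 0"
      unfolding as using snoc len' by (intro partial_coboundary_one_before[OF T]) auto
    ultimately show ?thesis by (simp add: coboundary_eq_partial clinear_zero[OF ract_linear(1)])
  qed
qed

section \<open>Cocycles on tuples with vanishing consecutive products\<close>

lemma successively_nth:
  "successively P xs \<Longrightarrow> Suc i < length xs \<Longrightarrow> P (xs ! i) (xs ! Suc i)"
proof (induction P xs arbitrary: i rule: successively.induct)
  case (3 P x y xs)
  then show ?case by (cases i) auto
qed auto

text \<open>Each merge of \<open>x # vs\<close> has a zero entry, so the cocycle identity reduces to
  its two outer terms. The right one ends with the action of the last entry, and that entry times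
  \<open>d\<close> is zero.\<close>

lemma cocycle_zero_products:
  assumes S: "cocycle lact ract n S" and len: "length vs = n"
    and zero: "successively (\<lambda>a b. a * b = 0) (x # vs @ [d])"
  shows "ract (lact x (S vs)) d = 0"
proof -
  let ?as = "x # vs"
  have lin: "multilinear n S" using S by (simp add: cocycle_def)
  have nth_as: "(?as @ [d]) ! i = ?as ! i" if "i \<le> n" for i
    using that len by (simp only: nth_append) simp
  have nth: "(?as @ [d]) ! i * (?as @ [d]) ! Suc i = 0" if "i \<le> n" for i
    using successively_nth[OF zero, of i] that len by simp
  have "S (merge_at j ?as) = 0" if j: "1 \<le> j" "j \<le> n" for j
  proof (rule multilinear_zero[OF lin])
    show "length (merge_at j ?as) = n" using j len by (simp add: length_merge_at)
    have "?as ! (j - 1) * ?as ! j = 0"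
      using nth[of "j - 1"] nth_as[of "j - 1"] nth_as[of j] j by simp
    then show "0 \<in> set (merge_at j ?as)" by (simp add: merge_at_def)
  qed
  then have "partial_coboundary lact n S ?as = lact x (S vs)"
    by (simp add: partial_coboundary_def)
  moreover have "coboundary lact ract n S ?as = 0" using S len by (simp add: cocycle_def)
  ultimately have "lact x (S vs) = (- ((-1) ^ (n + 1))) *\<^sub>R ract (S (take n ?as)) (?as ! n)"
    by (simp add: coboundary_eq_partial eq_neg_iff_add_eq_0)
  moreover have "?as ! n * d = 0" using nth[of n] len nth_as[of n] by (simp add: nth_append)
  ultimately show ?thesis
    by (simp add: clinear_scaleR[OF ract_linear(1)] ract_mult clinear_zero[OF ract_linear(2)])
qed

text \<open>
  For \<open>k = 0\<close> this is the only consequence of locality that is used. Each step of the induction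
  applies balancedness to the slots \<open>k\<close> and \<open>k + 1\<close>, and the last step, with \<open>d\<close> in the role
  of slot \<open>n + 1\<close>, produces the coboundary itself.
\<close>

lemma local_cocycle_zero_products:
  assumes zpb: "zero_product_balanced TYPE('u) TYPE('x)"
    and T: "bounded_local_cocycle lact ract n T" and norm: "normalized n T"
  shows "length us = k \<Longrightarrow> length us + length vs = n \<Longrightarrow>
    successively (\<lambda>a b. a * b = 0) (x # vs @ [d]) \<Longrightarrow>
    ract (partial_coboundary lact k T (us @ x # vs)) d = 0"
proof (induction k arbitrary: us x vs)
  case 0
  obtain S where S: "cocycle lact ract n S" "T vs = S vs"
    using T 0 by (auto simp: bounded_local_cocycle_def local_cocycle_def)
  then show ?case
    using cocycle_zero_products[OF S(1) _ 0(3)] 0 by (simp add: partial_coboundary_0)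
next
  case (Suc k)
  obtain ws w where us: "us = ws @ [w]" using Suc.prems by (cases us rule: rev_cases) auto
  have lws: "length ws = k" using Suc.prems us by simp
  have T': "bounded_multilinear n T" using T by (simp add: bounded_local_cocycle_def)
  \<comment> \<open>Attaching \<open>x\<close> to the second slot preserves the other conditions: v
    x annihilates the next entry because \<open>x\<close> does, and u v = 0 gives u (v x) = 0. At v
    = 1 the entry \<open>x\<close> is recovered.\<close>
  define \<phi> where "\<phi> u v = ract (partial_coboundary lact k T (ws @ u # (v * x) # vs)) d" for u v
  have "bounded_cbilinear (\<lambda>u v. partial_coboundary lact k T (ws @ u # v # vs))"
    using Suc.prems us
    by (intro bounded_multilinear_two_slots[OF
          bounded_multilinear_partial_coboundary[OF lact_bilinear T']]) auto
  then have "bounded_cbilinear \<phi>"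
    unfolding \<phi>_def
    by (rule bounded_cbilinear_compose[OF bounded_clinear_fix_right[OF ract_bilinear] _
          bounded_clinear_ident bounded_clinear_mult_left])
  moreover have "\<phi> u v = 0" if uv: "u * v = 0" for u v
    unfolding \<phi>_def
  proof (rule Suc.IH)
    have "u * (v * x) = 0" using uv by (simp add: mult.assoc[symmetric])
    moreover have "successively (\<lambda>a b. a * b = 0) (v * x # vs @ [d])"
      using Suc.prems(3) by (auto simp: successively_Cons mult.assoc)
    ultimately show "successively (\<lambda>a b. a * b = 0) (u # (v * x # vs) @ [d])" by simp
  qed (use lws us Suc.prems in auto)
  ultimately have "\<phi> w 1 = \<phi> 1 w"
    using zpb unfolding zero_product_balanced_def by blast
  \<comment> \<open>The value at u = 1 has collapsed to one term, with sign opposite to that of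
    summand k + 1 of the coboundary; adding that summand therefore gives 0.\<close>
  then have "ract (partial_coboundary lact k T (ws @ w # x # vs)) d =
      (-1) ^ k *\<^sub>R ract (T (ws @ (w * x) # vs)) d"
    using partial_coboundary_one_at[OF norm, of ws "(w * x) # vs"] Suc.prems us
    by (simp add: \<phi>_def lws clinear_scaleR[OF ract_linear(1)])
  then show ?case
    using merge_at_append[of ws w x vs]
    by (simp add: us lws partial_coboundary_Suc clinear_diff[OF ract_linear(1)]
        clinear_add[OF ract_linear(1)] clinear_scaleR[OF ract_linear(1)])
qed

text \<open>For k = n only the condition between the last slot and \<open>d\<close> is left. Then
  \<open>\<phi> w 1\<close> is the full partial coboundary, and \<open>\<phi> 1 w\<close> is the
  negative of the right action term.\<close>

theorem normalized_local_cocycle_is_cocycle: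
  assumes zpb: "zero_product_balanced TYPE('u) TYPE('x)"
    and T: "bounded_local_cocycle lact ract n T" and norm: "normalized n T"
  shows "cocycle lact ract n T"
  unfolding cocycle_def
proof (intro conjI allI impI)
  show "multilinear n T" using T by (simp add: bounded_local_cocycle_def local_cocycle_def)
  fix as :: "'u list" assume "length as = n + 1"
  then obtain us w where as: "as = us @ [w]" and us: "length us = n"
    by (cases as rule: rev_cases) auto
  have T': "bounded_multilinear n T" using T by (simp add: bounded_local_cocycle_def)
  define \<phi> where "\<phi> u v = ract (partial_coboundary lact n T (us @ [u])) v" for u v
  have "bounded_clinear (\<lambda>u. partial_coboundary lact n T (us @ [u]))"
    using us by (intro bounded_multilinear_slot[OF
          bounded_multilinear_partial_coboundary[OF lact_bilinear T']]) auto
  then have "bounded_cbilinear \<phi>"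
    unfolding \<phi>_def
    by (rule bounded_cbilinear_compose[OF bounded_clinear_ident ract_bilinear _ bounded_clinear_ident])
  moreover have "\<phi> u v = 0" if "u * v = 0" for u v
    unfolding \<phi>_def using us that by (intro local_cocycle_zero_products[OF zpb T norm]) auto
  ultimately have "\<phi> w 1 = \<phi> 1 w"
    using zpb unfolding zero_product_balanced_def by blast
  then have "partial_coboundary lact n T as = (-1) ^ n *\<^sub>R ract (T us) w"
    using partial_coboundary_one_at[OF norm, of us "[]"] us
    by (simp add: \<phi>_def as ract_one clinear_scaleR[OF ract_linear(1)])
  then show "coboundary lact ract n T as = 0"
    using us by (simp add: coboundary_eq_partial as nth_append)
qed

end

section \<open>Extension to the unitization\<close>

definition unitize_lact :: "('a \<Rightarrow> 'x \<Rightarrow> 'x) \<Rightarrow> 'a unitization \<Rightarrow> 'x \<Rightarrow> 'x::complex_normed_vector"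
  where "unitize_lact lact u x = lact (algebra_part u) x + scalar_part u *\<^sub>C x"

definition unitize_ract :: "('x \<Rightarrow> 'a \<Rightarrow> 'x) \<Rightarrow> 'x \<Rightarrow> 'a unitization \<Rightarrow> 'x::complex_normed_vector"
  where "unitize_ract ract x u = ract x (algebra_part u) + scalar_part u *\<^sub>C x"

text \<open>On multilinear maps this is the unique normalized multilinear extension: expanding each
  argument, every term with a factor 1 must vanish.\<close>

definition unitize_cochain :: "('a list \<Rightarrow> 'x) \<Rightarrow> 'a unitization list \<Rightarrow> 'x"
  where "unitize_cochain T us = T (map algebra_part us)"

lemma unitize_cochain_Unitize [simp]: "unitize_cochain T (map (\<lambda>a. Unitize a 0) as) = T as"
  by (simp add: unitize_cochain_def o_def)

lemma bounded_cbilinear_unitize: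
  assumes "bounded_cbilinear lact"
  shows "bounded_cbilinear (unitize_lact lact)"
  unfolding bounded_cbilinear_def
proof (intro conjI allI)
  note lin = bounded_cbilinearD[OF assms]
  note simps = clinear_add[OF lin(1)] clinear_add[OF lin(2)] clinear_scaleC[OF lin(1)]
    clinear_scaleC[OF lin(2)]
  show "clinear (\<lambda>u. unitize_lact lact u x)" for x
    by (simp add: clinear_def unitize_lact_def unitization_defs simps scaleC_add_left
        scaleC_add_right scaleC_scaleC)
  show "clinear (unitize_lact lact u)" for u
    by (simp add: clinear_def unitize_lact_def simps scaleC_add_left scaleC_add_right
        scaleC_scaleC mult.commute)
  obtain K where K: "0 \<le> K" "\<And>a x. norm (lact a x) \<le> K * norm a * norm x"
    using bounded_cbilinear_bound[OF assms] by blast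
  have "norm (unitize_lact lact u x) \<le> (K + 1) * norm u * norm x" for u x
  proof -
    have "norm (unitize_lact lact u x) \<le> K * norm (algebra_part u) * norm x + cmod (scalar_part u) * norm x"
      unfolding unitize_lact_def
      using norm_triangle_ineq[of "lact (algebra_part u) x" "scalar_part u *\<^sub>C x"] K(2)[of "algebra_part u" x]
      by (simp add: norm_scaleC)
    also have "\<dots> \<le> K * norm u * norm x + norm u * norm x"
      using K(1) by (intro add_mono mult_right_mono mult_left_mono norm_algebra_part_le norm_scalar_part_le) auto
    finally show ?thesis by (simp add: algebra_simps)
  qed
  then show "\<exists>K. \<forall>u x. norm (unitize_lact lact u x) \<le> K * norm u * norm x" by blast
qed

lemma bounded_cbilinear_swap:
  assumes "bounded_cbilinear \<phi>" shows "bounded_cbilinear (\<lambda>x y. \<phi> y x)"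
proof -
  obtain K where "\<And>x y. norm (\<phi> x y) \<le> K * norm x * norm y"
    using bounded_cbilinear_bound[OF assms] by blast
  then have "norm (\<phi> y x) \<le> K * norm x * norm y" for x y by (simp add: mult_ac)
  then show ?thesis
    using bounded_cbilinearD[OF assms] unfolding bounded_cbilinear_def by (intro conjI exI allI)
qed

lemma unitize_ract_eq: "unitize_ract ract = (\<lambda>x u. unitize_lact (\<lambda>a x. ract x a) u x)"
  by (simp add: fun_eq_iff unitize_ract_def unitize_lact_def)

lemma unital_bimodule_unitize:
  fixes lact :: "'a::comm_complex_banach_algebra \<Rightarrow> 'x::complex_banach \<Rightarrow> 'x"
  assumes bm: "banach_bimodule lact ract"
  shows "unital_bimodule (unitize_lact lact) (unitize_ract ract)"
proof -
  have L: "bounded_cbilinear lact" and R: "bounded_cbilinear ract"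
    and Lm: "lact (a * b) x = lact a (lact b x)" and Rm: "ract x (a * b) = ract (ract x a) b"
    and LR: "ract (lact a x) b = lact a (ract x b)" for a b x
    using bm by (auto simp: banach_bimodule_def banach_left_module_def banach_right_module_def)
  note lin = bounded_cbilinearD[OF L] bounded_cbilinearD[OF R]
  note simps = lin[THEN clinear_add] lin[THEN clinear_scaleC] lin[THEN clinear_zero] Lm Rm LR
    scaleC_add_right scaleC_add_left scaleC_scaleC
  have "bounded_cbilinear (unitize_ract ract)"
    unfolding unitize_ract_eq
    by (rule bounded_cbilinear_swap[OF bounded_cbilinear_unitize[OF bounded_cbilinear_swap[OF R]]])
  moreover have "unitize_lact lact (u * v) x = unitize_lact lact u (unitize_lact lact v x)" for u v x
    by (simp add: unitize_lact_def times_unitization_def simps mult.commute add_ac)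
  moreover have "unitize_ract ract x (u * v) = unitize_ract ract (unitize_ract ract x u) v" for u v x
    by (simp add: unitize_ract_def times_unitization_def simps mult.commute add_ac)
  moreover have "unitize_ract ract (unitize_lact lact u x) v = unitize_lact lact u (unitize_ract ract x v)"
    for u v x
    by (simp add: unitize_lact_def unitize_ract_def simps mult.commute add_ac)
  ultimately have "banach_bimodule (unitize_lact lact) (unitize_ract ract)"
    using bounded_cbilinear_unitize[OF L]
    by (simp add: banach_bimodule_def banach_left_module_def banach_right_module_def)
  then show ?thesis
    by unfold_locales
      (simp_all add: unitize_lact_def unitize_ract_def one_unitization_def simps)
qed

lemma multilinear_unitize_cochain:
  assumes "multilinear n T" shows "multilinear n (unitize_cochain T)"
proof (rule multilinearI)
  fix us vs :: "'a unitization list" assume "length us + length vs + 1 = n"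
  then have "clinear (\<lambda>a. T (map algebra_part us @ a # map algebra_part vs))"
    by (intro multilinearD[OF assms]) simp
  moreover have "clinear (algebra_part :: 'a unitization \<Rightarrow> 'a)"
    by (simp add: clinear_def unitization_defs)
  ultimately show "clinear (\<lambda>u. unitize_cochain T (us @ u # vs))"
    unfolding unitize_cochain_def using clinear_compose by fastforce
qed

lemma bounded_multilinear_unitize_cochain:
  assumes "bounded_multilinear n T" shows "bounded_multilinear n (unitize_cochain T)"
proof -
  obtain K where K0: "0 \<le> K"
    and K: "\<And>as. length as = n \<Longrightarrow> norm (T as) \<le> K * (\<Prod>a\<leftarrow>as. norm a)"
    using bounded_multilinear_bound[OF assms] by blast
  have "0 \<le> (\<Prod>u\<leftarrow>us. norm (algebra_part u)) \<and>
    (\<Prod>u\<leftarrow>us. norm (algebra_part u)) \<le> (\<Prod>u\<leftarrow>us. norm u)" for us :: "'a unitization list"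
    by (induction us) (auto intro!: mult_mono norm_algebra_part_le)
  then have le: "(\<Prod>u\<leftarrow>us. norm (algebra_part u)) \<le> (\<Prod>u\<leftarrow>us. norm u)" for us :: "'a unitization list"
    by blast
  have "norm (unitize_cochain T us) \<le> K * (\<Prod>u\<leftarrow>us. norm u)" if "length us = n" for us
    using K[of "map algebra_part us"] mult_left_mono[OF le K0, of us] that
    by (simp add: unitize_cochain_def o_def)
  then show ?thesis
    using assms multilinear_unitize_cochain unfolding bounded_multilinear_def by blast
qed

lemma normalized_unitize_cochain:
  assumes "multilinear n T"
  shows "normalized n (unitize_cochain (T :: 'a::comm_complex_banach_algebra list \<Rightarrow> _))"
  unfolding normalized_def
proof (intro allI impI, elim conjE)
  fix us :: "'a unitization list" assume "length us = n" "1 \<in> set us"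
  moreover have "algebra_part (1 :: 'a unitization) = 0" by (simp add: one_unitization_def)
  ultimately show "unitize_cochain T us = 0"
    unfolding unitize_cochain_def by (intro multilinear_zero[OF assms]) (auto simp: image_iff)
qed

text \<open>Each argument splits into an element of the algebra and a multiple of 1. The induction
  works through the remaining tail, with \<open>as\<close> the prefix already reduced to the
  algebra.\<close>

lemma multilinear_unitization_eq_0:
  fixes F :: "'a::comm_complex_banach_algebra unitization list \<Rightarrow> 'x::complex_normed_vector"
  assumes F: "multilinear m F"
    and base: "\<And>as. length as = m \<Longrightarrow> F (map (\<lambda>a. Unitize a 0) as) = 0"
    and one: "\<And>us. length us = m \<Longrightarrow> 1 \<in> set us \<Longrightarrow> F us = 0"
    and len: "length us = m"
  shows "F us = 0"
proof -
  have "F (map (\<lambda>a. Unitize a 0) as @ us) = 0" if "length as + length us = m" for as us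
    using that
  proof (induction us arbitrary: as)
    case Nil
    then show ?case using base by simp
  next
    case (Cons u us)
    let ?as = "map (\<lambda>a. Unitize a 0) as"
    obtain a c where "u = Unitize a c" by (cases u)
    then have u: "u = Unitize a 0 + c *\<^sub>C 1" using Unitize_decompose by simp
    have lin: "clinear (\<lambda>v. F (?as @ v # us))" using Cons.prems by (intro multilinearD[OF F]) simp
    have "F (?as @ 1 # us) = 0" using Cons.prems by (intro one) auto
    moreover have "F (?as @ Unitize a 0 # us) = 0" using Cons.IH[of "as @ [a]"] Cons.prems by simp
    ultimately show ?case
      unfolding u by (simp add: clinear_add[OF lin] clinear_scaleC[OF lin])
  qed
  from this[of "[]" us] len show ?thesis by simp
qed

lemma coboundary_unitize_cochain:
  fixes lact :: "'a::comm_complex_banach_algebra \<Rightarrow> 'x::complex_banach \<Rightarrow> 'x"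
  assumes "length as = n + 1"
  shows "coboundary (unitize_lact lact) (unitize_ract ract) n (unitize_cochain T)
      (map (\<lambda>a. Unitize a 0) as) = coboundary lact ract n T as"
proof -
  let ?f = "\<lambda>a. Unitize a 0"
  have "unitize_cochain T (merge_at j (map ?f as)) = T (merge_at j as)" if "j \<in> {1..n}" for j
  proof -
    have "j - 1 < length as" "j < length as" using that assms by auto
    then have "merge_at j (map ?f as) = map ?f (merge_at j as)"
      by (simp add: merge_at_def take_map drop_map Unitize_mult)
    then show ?thesis by simp
  qed
  then have "(\<Sum>j = 1..n. (-1) ^ j *\<^sub>R unitize_cochain T (merge_at j (map ?f as))) =
      (\<Sum>j = 1..n. (-1) ^ j *\<^sub>R T (merge_at j as))"
    by (intro sum.cong refl) (simp only:)
  then show ?thesis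
    using assms
    by (simp add: coboundary_eq_partial partial_coboundary_def unitize_lact_def unitize_ract_def
        take_map drop_map)
qed

text \<open>The witnesses may be unbounded, so the argument is algebraic: the coboundary is
  multilinear, is the original one on the algebra, and vanishes at a 1 by normalization.\<close>

lemma cocycle_unitize:
  fixes lact :: "'a::comm_complex_banach_algebra \<Rightarrow> 'x::complex_banach \<Rightarrow> 'x"
  assumes bm: "banach_bimodule lact ract" and S: "cocycle lact ract n S"
  shows "cocycle (unitize_lact lact) (unitize_ract ract) n (unitize_cochain S)"
proof -
  interpret U: unital_bimodule "unitize_lact lact" "unitize_ract ract"
    by (rule unital_bimodule_unitize[OF bm])
  have lin: "multilinear n S" using S by (simp add: cocycle_def)
  have "coboundary (unitize_lact lact) (unitize_ract ract) n (unitize_cochain S) us = 0"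
    if "length us = n + 1" for us
  proof (rule multilinear_unitization_eq_0[OF _ _ _ that])
    show "multilinear (n + 1) (coboundary (unitize_lact lact) (unitize_ract ract) n (unitize_cochain S))"
      by (intro multilinear_coboundary U.lact_bilinear U.ract_bilinear multilinear_unitize_cochain lin)
    show "coboundary (unitize_lact lact) (unitize_ract ract) n (unitize_cochain S)
        (map (\<lambda>a. Unitize a 0) as) = 0" if "length as = n + 1" for as
      using S that by (simp add: coboundary_unitize_cochain cocycle_def)
    show "coboundary (unitize_lact lact) (unitize_ract ract) n (unitize_cochain S) us = 0"
      if "length us = n + 1" "1 \<in> set us" for us
      using that by (intro U.coboundary_one normalized_unitize_cochain lin)
  qed
  then show ?thesis using multilinear_unitize_cochain[OF lin] by (simp add: cocycle_def)
qed

theorem theorem3p3: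
  fixes lact :: "'a::comm_complex_banach_algebra \<Rightarrow> 'x::complex_banach \<Rightarrow> 'x"
    and ract :: "'x \<Rightarrow> 'a \<Rightarrow> 'x"
    and n :: nat
    and T :: "'a list \<Rightarrow> 'x"
  assumes "hyper_tauberian TYPE('a)"
    and "banach_bimodule lact ract"
    and "1 \<le> n"
    and "bounded_local_cocycle lact ract n T"
  shows "cocycle lact ract n T"
proof -
  interpret U: unital_bimodule "unitize_lact lact" "unitize_ract ract"
    by (rule unital_bimodule_unitize[OF assms(2)])
  have lin: "multilinear n T" and bdd: "bounded_multilinear n T"
    and loc: "\<And>as. length as = n \<Longrightarrow> \<exists>S. cocycle lact ract n S \<and> T as = S as"
    using assms(4) by (auto simp: bounded_local_cocycle_def local_cocycle_def)
  \<comment> \<open>The extension sees only algebra parts, so a witness for the tuple of these parts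
    extends to a witness for \<open>us\<close>.\<close>
  have "\<exists>S. cocycle (unitize_lact lact) (unitize_ract ract) n S \<and> unitize_cochain T us = S us"
    if len: "length us = n" for us
  proof -
    obtain S where "cocycle lact ract n S" "T (map algebra_part us) = S (map algebra_part us)"
      using loc[of "map algebra_part us"] len by auto
    then show ?thesis
      using cocycle_unitize[OF assms(2)] by (intro exI[of _ "unitize_cochain S"]) (simp add: unitize_cochain_def)
  qed
  then have "bounded_local_cocycle (unitize_lact lact) (unitize_ract ract) n (unitize_cochain T)"
    using multilinear_unitize_cochain[OF lin] bounded_multilinear_unitize_cochain[OF bdd]
    by (simp add: bounded_local_cocycle_def local_cocycle_def)
  then have coc: "cocycle (unitize_lact lact) (unitize_ract ract) n (unitize_cochain T)"
    by (rule U.normalized_local_cocycle_is_cocycle[OF zero_product_balanced_unitization[OF assms(1)]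
          _ normalized_unitize_cochain[OF lin]])
  have "coboundary lact ract n T as = 0" if "length as = n + 1" for as
    using coc that coboundary_unitize_cochain[OF that, of lact ract T] by (simp add: cocycle_def)
  then show ?thesis using lin by (simp add: cocycle_def)
qed

end
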